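(* Let $\Bbbk$ be a field, let $S=\Bbbk[X]$ be a polynomial ring in a finite set of variables $X$ partitioned as $X = X_1\cup\cdots\cup X_r$ (variables of $r$ colors), with the $\mathbb{N}^r$-grading in which each variable in $X_i$ has multidegree $e_i$. Let $d$ be an integer and let $I\subseteq S$ be an ideal which is homogeneous for the $\mathbb{N}^r$-grading, is generated in (total) degree $d+1$ and is $(d+1)$-regular, so that it has linear resolution. Suppose that for each $i=1,\ldots,r$ the ideal $I$ contains an element of pure color $i$. Let $\Omega^l$ be the $l$-th syzygy module in an $\mathbb{N}^r$-graded free resolution of $S/I$ (so $\Omega^1=I$). Then for each $l=1,\ldots,r$ and each color vector $\mathbf{a}=(a_1,\ldots,a_r)\in\mathbb{N}^r$ with $\sum_{i=1}^r a_i = d+l$, letting $s$ be the number of nonzero coordinates of $\mathbf{a}$, one has $$\dim_{\Bbbk} (\Omega^l)_{\mathbf{a}} \;\ge\; \binom{s-1}{l-1}.$$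
   Context: $\mathbb{N}$ denotes the nonnegative integers and $e_i\in\mathbb{N}^r$ is the $i$-th unit coordinate vector. A nonzero polynomial which is homogeneous for the $\mathbb{N}^r$-grading of multidegree $\mathbf{a}=(a_1,\ldots,a_r)$ is said to have color vector $(a_1,\ldots,a_r)$. A nonzero homogeneous polynomial with color vector $r_i e_i$, where $r_i$ is a positive integer, is said to have pure color $i$. Regularity: let $G_\bullet$ be a minimal graded free resolution of $I$ (for the total-degree grading) with terms $G_p=\bigoplus_{i\in\mathbb{Z}} S(-i)^{\beta_{p,i}}$. The ideal $I$ is $m$-regular if $i\le m+p$ for every nonzero $\beta_{p,i}$. Syzygies: for an $\mathbb{N}^r$-graded free resolution $\cdots\to F_2\to F_1\to F_0=S$ of $S/I$, the $l$-th syzygy module $\Omega^l$ is the image of $F_l\to F_{l-1}$, for $l\ge 1$. $(\Omega^l)_{\mathbf{a}}$ denotes its graded piece of multidegree $\mathbf{a}$. *)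

theory Defs
  imports Complex_Main "HOL-Library.Poly_Mapping" "HOL-Library.Extended_Nat"
    "HOL-Library.Cardinality"
begin

text \<open>Polynomials in the variables \<open>'x\<close>: finitely supported maps from exponent vectors to
  coefficients, with the convolution product of the library.\<close>

type_synonym ('x, 'k) mpoly = "('x \<Rightarrow>\<^sub>0 nat) \<Rightarrow>\<^sub>0 'k"

text \<open>A grading of the polynomial ring is given by a degree function on exponent vectors.
  A partition of the variables into colour classes is a map \<open>col :: 'x \<Rightarrow> 'c\<close>, the class of
  colour \<open>i\<close> being \<open>col -` {i}\<close>; the number \<open>r\<close> of colours is \<open>CARD('c)\<close> and
  \<open>'c \<Rightarrow>\<^sub>0 nat\<close> plays the role of \<open>\<nat>\<^sup>r\<close>.\<close>

definition total_deg :: "('x::finite \<Rightarrow>\<^sub>0 nat) \<Rightarrow> int" where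
  "total_deg m = int (\<Sum>x\<in>UNIV. Poly_Mapping.lookup m x)"

definition color_deg :: "('x::finite \<Rightarrow> 'c) \<Rightarrow> ('x \<Rightarrow>\<^sub>0 nat) \<Rightarrow> ('c \<Rightarrow>\<^sub>0 nat)" where
  "color_deg col m = (\<Sum>x\<in>UNIV. Poly_Mapping.single (col x) (Poly_Mapping.lookup m x))"

text \<open>The zero polynomial is homogeneous of every degree.\<close>

definition homogeneous :: "(('x \<Rightarrow>\<^sub>0 nat) \<Rightarrow> 'g) \<Rightarrow> 'g \<Rightarrow> ('x, 'k::zero) mpoly \<Rightarrow> bool" where
  "homogeneous deg g f \<longleftrightarrow> (\<forall>m\<in>Poly_Mapping.keys f. deg m = g)"

definition has_color_vector ::
    "('x::finite \<Rightarrow> 'c) \<Rightarrow> ('c \<Rightarrow>\<^sub>0 nat) \<Rightarrow> ('x, 'k::zero) mpoly \<Rightarrow> bool" where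
  "has_color_vector col a f \<longleftrightarrow> f \<noteq> 0 \<and> homogeneous (color_deg col) a f"

definition pure_color :: "('x::finite \<Rightarrow> 'c) \<Rightarrow> 'c \<Rightarrow> ('x, 'k::zero) mpoly \<Rightarrow> bool" where
  "pure_color col i f \<longleftrightarrow> (\<exists>n>0. has_color_vector col (Poly_Mapping.single i n) f)"

text \<open>Ideals are submodules of the ring over itself.\<close>

definition is_ideal :: "'a::comm_ring_1 set \<Rightarrow> bool" where
  "is_ideal I \<longleftrightarrow> module.subspace (*) I"

definition ideal_gen :: "'a::comm_ring_1 set \<Rightarrow> 'a set" where
  "ideal_gen A = module.span (*) A"

definition homogeneous_ideal ::
    "(('x \<Rightarrow>\<^sub>0 nat) \<Rightarrow> 'g) \<Rightarrow> ('x, 'k::comm_ring_1) mpoly set \<Rightarrow> bool" where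
  "homogeneous_ideal deg I \<longleftrightarrow>
     is_ideal I \<and> I = ideal_gen {f \<in> I. \<exists>g. homogeneous deg g f}"

definition generated_in_degree ::
    "int \<Rightarrow> ('x::finite, 'k::comm_ring_1) mpoly set \<Rightarrow> bool" where
  "generated_in_degree e I \<longleftrightarrow> is_ideal I \<and> I = ideal_gen {f \<in> I. homogeneous total_deg e f}"

text \<open>Free modules: \<open>'b \<Rightarrow>\<^sub>0 'a\<close> is free on \<open>'b\<close>, and \<open>free_mod B\<close> is its free direct summand
  with basis \<open>B\<close>.\<close>

definition smul :: "'a::comm_ring_1 \<Rightarrow> ('b \<Rightarrow>\<^sub>0 'a) \<Rightarrow> ('b \<Rightarrow>\<^sub>0 'a)" where
  "smul c v = Poly_Mapping.map ((*) c) v"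

definition free_mod :: "'b set \<Rightarrow> ('b \<Rightarrow>\<^sub>0 'a::zero) set" where
  "free_mod B = {v. Poly_Mapping.keys v \<subseteq> B}"

lemma lookup_smul: "Poly_Mapping.lookup (smul c v) b = c * Poly_Mapping.lookup v b"
  by (simp add: smul_def Poly_Mapping.map.rep_eq when_def)

lemma module_smul: "module smul"
  by unfold_locales (auto intro!: poly_mapping_eqI simp: lookup_smul lookup_add algebra_simps)

text \<open>If the basis element \<open>b\<close> has degree \<open>s b\<close>, the free module is
  \<open>\<Oplus>\<^sub>b S(-s b)\<close>; this is membership in its graded piece of degree \<open>g\<close>.\<close>

definition homogeneous_vec ::
    "(('x \<Rightarrow>\<^sub>0 nat) \<Rightarrow> 'g::comm_monoid_add) \<Rightarrow> ('b \<Rightarrow> 'g) \<Rightarrow> 'g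
       \<Rightarrow> ('b \<Rightarrow>\<^sub>0 ('x, 'k::zero) mpoly) \<Rightarrow> bool" where
  "homogeneous_vec deg s g v \<longleftrightarrow>
     (\<forall>b\<in>Poly_Mapping.keys v.
        \<forall>m\<in>Poly_Mapping.keys (Poly_Mapping.lookup v b). s b + deg m = g)"

text \<open>The scalar field acts through the constant polynomials.\<close>

definition kscale :: "'k::field \<Rightarrow> ('b \<Rightarrow>\<^sub>0 ('x, 'k) mpoly) \<Rightarrow> ('b \<Rightarrow>\<^sub>0 ('x, 'k) mpoly)" where
  "kscale c v = smul (Poly_Mapping.single 0 c) v"

lemma vector_space_kscale: "vector_space kscale"
proof -
  interpret module smul by (rule module_smul)
  show ?thesis
    by unfold_locales
      (simp_all add: kscale_def single_add mult_single
        scale_left_distrib scale_right_distrib)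
qed

text \<open>The library's \<open>dim\<close> is a natural number and carries no information in infinite
  dimension.\<close>

definition kdim :: "('b \<Rightarrow>\<^sub>0 ('x, 'k::field) mpoly) set \<Rightarrow> enat" where
  "kdim V = (if \<exists>A. finite A \<and> V \<subseteq> module.span kscale A
             then enat (vector_space.dim kscale V) else \<infinity>)"

text \<open>A complex \<open>\<dots> \<rightarrow> F\<^sub>2 \<rightarrow> F\<^sub>1 \<rightarrow> F\<^sub>0\<close> of graded free modules
  \<open>F\<^sub>p = free_mod (B p)\<close> with basis degrees \<open>s p\<close>, exact in all positive homological degrees.
  The differential \<open>F\<^sub>p \<rightarrow> F\<^sub>p\<^sub>-\<^sub>1\<close> is \<open>d p\<close> for \<open>p \<ge> 1\<close>, and \<open>d 0\<close> is irrelevant. Since \<open>F\<^sub>p\<close> is a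
  direct summand of the whole type, asking \<open>d p\<close> to be linear on the whole type is no
  restriction on the map \<open>F\<^sub>p \<rightarrow> F\<^sub>p\<^sub>-\<^sub>1\<close>.\<close>

definition graded_free_complex ::
    "(('x \<Rightarrow>\<^sub>0 nat) \<Rightarrow> 'g::comm_monoid_add) \<Rightarrow> (nat \<Rightarrow> 'b set) \<Rightarrow> (nat \<Rightarrow> 'b \<Rightarrow> 'g)
       \<Rightarrow> (nat \<Rightarrow> ('b \<Rightarrow>\<^sub>0 ('x, 'k::field) mpoly) \<Rightarrow> ('b \<Rightarrow>\<^sub>0 ('x, 'k) mpoly)) \<Rightarrow> bool" where
  "graded_free_complex deg B s d \<longleftrightarrow>
     (\<forall>p. module_hom smul smul (d (Suc p))
        \<and> d (Suc p) ` free_mod (B (Suc p)) \<subseteq> free_mod (B p)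
        \<and> (\<forall>v\<in>free_mod (B (Suc p)). \<forall>g. homogeneous_vec deg (s (Suc p)) g v
              \<longrightarrow> homogeneous_vec deg (s p) g (d (Suc p) v))
        \<and> {v \<in> free_mod (B (Suc p)). d (Suc p) v = 0}
            = d (Suc (Suc p)) ` free_mod (B (Suc (Suc p))))"

text \<open>Graded free resolution \<open>\<dots> \<rightarrow> F\<^sub>1 \<rightarrow> F\<^sub>0 = S \<rightarrow> S/I\<close>: here \<open>F\<^sub>0\<close> is free on one basis
  element \<open>b\<close> of degree 0, and the image of \<open>F\<^sub>1\<close> is the kernel \<open>I\<close> of \<open>S \<rightarrow> S/I\<close>.\<close>

definition quotient_resolution ::
    "(('x \<Rightarrow>\<^sub>0 nat) \<Rightarrow> 'g::comm_monoid_add) \<Rightarrow> (nat \<Rightarrow> 'b set) \<Rightarrow> (nat \<Rightarrow> 'b \<Rightarrow> 'g)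
       \<Rightarrow> (nat \<Rightarrow> ('b \<Rightarrow>\<^sub>0 ('x, 'k::field) mpoly) \<Rightarrow> ('b \<Rightarrow>\<^sub>0 ('x, 'k) mpoly))
       \<Rightarrow> ('x, 'k) mpoly set \<Rightarrow> bool" where
  "quotient_resolution deg B s d I \<longleftrightarrow>
     graded_free_complex deg B s d
     \<and> (\<exists>b. B 0 = {b} \<and> s 0 b = 0 \<and> d 1 ` free_mod (B 1) = Poly_Mapping.single b ` I)"

text \<open>Graded free resolution \<open>\<dots> \<rightarrow> G\<^sub>1 \<rightarrow> G\<^sub>0 \<rightarrow> I\<close> with augmentation \<open>\<epsilon>\<close>.\<close>

definition ideal_resolution ::
    "(('x \<Rightarrow>\<^sub>0 nat) \<Rightarrow> 'g::comm_monoid_add) \<Rightarrow> (nat \<Rightarrow> 'b set) \<Rightarrow> (nat \<Rightarrow> 'b \<Rightarrow> 'g)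
       \<Rightarrow> (nat \<Rightarrow> ('b \<Rightarrow>\<^sub>0 ('x, 'k::field) mpoly) \<Rightarrow> ('b \<Rightarrow>\<^sub>0 ('x, 'k) mpoly))
       \<Rightarrow> (('b \<Rightarrow>\<^sub>0 ('x, 'k) mpoly) \<Rightarrow> ('x, 'k) mpoly) \<Rightarrow> ('x, 'k) mpoly set \<Rightarrow> bool" where
  "ideal_resolution deg B s d \<epsilon> I \<longleftrightarrow>
     graded_free_complex deg B s d
     \<and> module_hom smul (*) \<epsilon>
     \<and> (\<forall>v\<in>free_mod (B 0). \<forall>g. homogeneous_vec deg (s 0) g v \<longrightarrow> homogeneous deg g (\<epsilon> v))
     \<and> \<epsilon> ` free_mod (B 0) = I
     \<and> {v \<in> free_mod (B 0). \<epsilon> v = 0} = d 1 ` free_mod (B 1)"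

text \<open>Minimality: the image of \<open>G\<^sub>p\<^sub>+\<^sub>1 \<rightarrow> G\<^sub>p\<close> lies in \<open>\<mm> G\<^sub>p\<close>, where the ideal \<open>\<mm>\<close> generated by the
  variables consists of the polynomials without constant term.\<close>

definition minimal_complex ::
    "(nat \<Rightarrow> 'b set)
       \<Rightarrow> (nat \<Rightarrow> ('b \<Rightarrow>\<^sub>0 ('x, 'k::field) mpoly) \<Rightarrow> ('b \<Rightarrow>\<^sub>0 ('x, 'k) mpoly)) \<Rightarrow> bool" where
  "minimal_complex B d \<longleftrightarrow>
     (\<forall>p. \<forall>v\<in>free_mod (B (Suc p)). \<forall>b.
        Poly_Mapping.lookup (Poly_Mapping.lookup (d (Suc p) v) b) 0 = 0)"

text \<open>The term \<open>G\<^sub>p = \<Oplus>\<^sub>i S(-i)\<^bsup>\<beta>\<^sub>p\<^sub>,\<^sub>i\<^esup>\<close> has \<open>\<beta>\<^sub>p\<^sub>,\<^sub>i\<close> basis elements of degree \<open>i\<close>. Minimal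
  resolutions are unique up to isomorphism and have finite ranks, so it is no restriction to
  index their bases by natural numbers.\<close>

definition regular_ideal :: "int \<Rightarrow> ('x::finite, 'k::field) mpoly set \<Rightarrow> bool" where
  "regular_ideal m I \<longleftrightarrow>
     (\<exists>(B :: nat \<Rightarrow> nat set) s d \<epsilon>.
        (\<forall>p. finite (B p)) \<and> ideal_resolution total_deg B s d \<epsilon> I \<and> minimal_complex B d
        \<and> (\<forall>p i. card {b \<in> B p. s p b = i} \<noteq> 0 \<longrightarrow> i \<le> m + int p))"

definition syzygy ::
    "(nat \<Rightarrow> 'b set)
       \<Rightarrow> (nat \<Rightarrow> ('b \<Rightarrow>\<^sub>0 ('x, 'k::field) mpoly) \<Rightarrow> ('b \<Rightarrow>\<^sub>0 ('x, 'k) mpoly))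
       \<Rightarrow> nat \<Rightarrow> ('b \<Rightarrow>\<^sub>0 ('x, 'k) mpoly) set" where
  "syzygy B d l = d l ` free_mod (B l)"

text \<open>The \<open>l\<close>-th syzygy module is graded as a submodule of \<open>F\<^sub>l\<^sub>-\<^sub>1\<close>, for \<open>l \<ge> 1\<close>.\<close>

definition syzygy_piece ::
    "(('x \<Rightarrow>\<^sub>0 nat) \<Rightarrow> 'g::comm_monoid_add) \<Rightarrow> (nat \<Rightarrow> 'b set) \<Rightarrow> (nat \<Rightarrow> 'b \<Rightarrow> 'g)
       \<Rightarrow> (nat \<Rightarrow> ('b \<Rightarrow>\<^sub>0 ('x, 'k::field) mpoly) \<Rightarrow> ('b \<Rightarrow>\<^sub>0 ('x, 'k) mpoly))
       \<Rightarrow> nat \<Rightarrow> 'g \<Rightarrow> ('b \<Rightarrow>\<^sub>0 ('x, 'k) mpoly) set" where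
  "syzygy_piece deg B s d l g = {v \<in> syzygy B d l. homogeneous_vec deg (s (l - 1)) g v}"

end

theory Submission
  imports Defs "HOL-Computational_Algebra.Fraction_Field"
begin

text \<open>
  Let \<open>F\<close> be the given resolution of \<open>S/I\<close>, and let \<open>ev\<close> be an injective ring homomorphism from
  \<open>S\<close> to a field \<open>Q\<close>. Call a set \<open>\<Gamma>\<close> of multidegrees convex if it contains every multidegree
  that lies between two of its elements. A convex \<open>\<Gamma>\<close> carries a graded \<open>S\<close>-module \<open>N\<^sub>\<Gamma>\<close> with one
  copy of \<open>Q\<close> in each degree \<open>c \<in> \<Gamma>\<close>: a polynomial \<open>f\<close> that is homogeneous of degree \<open>e\<close> maps the
  copy in degree \<open>c\<close> to the copy in degree \<open>c + e\<close> by multiplication with \<open>ev f\<close>, and to \<open>0\<close> if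
  \<open>c + e \<notin> \<Gamma>\<close>. A homomorphism \<open>F\<^sub>p \<rightarrow> N\<^sub>\<Gamma>\<close> of degree 0 is a \<open>Q\<close>-valued function on the basis
  elements of \<open>F\<^sub>p\<close> whose degree lies in \<open>\<Gamma>\<close>. Hence the degree-0 part \<open>H\<^sup>p(\<Gamma>)\<close> of
  \<open>Ext\<^sup>p(S/I, N\<^sub>\<Gamma>)\<close> is the cohomology of a complex of such functions. For \<open>\<Gamma> = {a}\<close> a cocycle in
  homological degree \<open>l\<close> induces a \<open>Q\<close>-valued functional on \<open>(\<Omega>\<^sup>l)\<^sub>a\<close> and is determined by it, so
  \<open>dim (\<Omega>\<^sup>l)\<^sub>a \<ge> dim H\<^sup>l({a})\<close> (lemma \<open>kdim_syzygy_piece\<close>), and it remains to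
  bound \<open>H\<^sup>l({a})\<close> from below.

  Three facts control \<open>H\<^sup>p(\<Gamma>)\<close>. Write \<open>|c|\<close> for the sum of the coordinates of \<open>c\<close>.

  \<^item> Ext may be computed from the linear resolution, whose \<open>p\<close>-th term is generated in total degree
    \<open>d + p\<close>. So \<open>H\<^sup>p(\<Gamma>) = 0\<close> for \<open>p \<ge> 1\<close> if no \<open>c \<in> \<Gamma>\<close> has \<open>|c| = d + p\<close>
    (lemma \<open>acyclic_compare\<close>).

  \<^item> If \<open>\<Gamma>\<close> is invariant under translation in the direction of colour \<open>i\<close>, an element \<open>f \<in> I\<close> of pure
    colour \<open>i\<close> acts bijectively on \<open>N\<^sub>\<Gamma>\<close> (here \<open>ev f \<noteq> 0\<close> matters), but it kills \<open>S/I\<close>. So all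
    \<open>H\<^sup>p(\<Gamma>)\<close> vanish (lemma \<open>acyclic_invariant\<close>).

  \<^item> If \<open>\<Gamma>\<close> is the disjoint union of \<open>\<Gamma>'\<close> and \<open>\<Gamma>''\<close>, and \<open>\<Gamma>'\<close> is closed upwards in \<open>\<Gamma>\<close>, there is
    a long exact sequence \<open>H\<^sup>p(\<Gamma>) \<rightarrow> H\<^sup>p(\<Gamma>'') \<rightarrow> H\<^sup>p\<^sup>+\<^sup>1(\<Gamma>') \<rightarrow> H\<^sup>p\<^sup>+\<^sup>1(\<Gamma>) \<rightarrow> H\<^sup>p\<^sup>+\<^sup>1(\<Gamma>'')\<close>.

  The last two facts allow one to replace a condition \<open>c\<^sub>i \<le> a\<^sub>i\<close> by \<open>c\<^sub>i > a\<^sub>i\<close> at the cost of raising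
  \<open>p\<close> by one, because the set without any condition on \<open>c\<^sub>i\<close> has no cohomology. Doing so for all
  \<open>r\<close> colours identifies \<open>H\<^sup>p({c. c \<le> a})\<close> with \<open>H\<^sup>p\<^sup>+\<^sup>r({c. c > a in every coordinate})\<close>. The degrees
  in the latter set satisfy \<open>|c| \<ge> |a| + r\<close>, so the first fact makes it zero if \<open>|a| > d + p\<close>.
  This is local duality in the guise of a Cech complex, and it is where the linearity of the
  resolution is used up to homological degree \<open>p + r\<close>.

  Finally, for a set \<open>E\<close> of colours let \<open>face E a\<close> consist of the \<open>c \<le> a\<close> that agree with \<open>a\<close> on
  \<open>E\<close>. Fixing one more coordinate \<open>i\<close> gives a long exact sequence that relates \<open>face (E \<union> {i}) a\<close>,
  \<open>face E a\<close> and \<open>face E (a - e\<^sub>i)\<close>. If \<open>|a| = d + p + 1\<close>, its two outer terms \<open>H\<^sup>p(face E a)\<close> and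
  \<open>H\<^sup>p\<^sup>+\<^sup>1(face E (a - e\<^sub>i))\<close> vanish: the former by the previous paragraph, extended to all faces
  (lemma \<open>acyclic_face\<close>), the latter by the first fact. The sequence becomes
  \<open>0 \<rightarrow> H\<^sup>p(face E (a - e\<^sub>i)) \<rightarrow> H\<^sup>p\<^sup>+\<^sup>1(face (E \<union> {i}) a) \<rightarrow> H\<^sup>p\<^sup>+\<^sup>1(face E a) \<rightarrow> 0\<close>.
  This is Pascal's recursion for the dimensions. It starts from \<open>H\<^sup>0({c. c \<le> a}) = Q\<close> for
  \<open>|a| = d\<close>, and reaches \<open>{a} = face E a\<close> when \<open>E\<close> is the support of \<open>a\<close>
  (lemma \<open>many_classes_face\<close>).
\<close>

section \<open>Linear maps on free modules\<close>

abbreviation "lk \<equiv> Poly_Mapping.lookup"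
abbreviation "supp \<equiv> Poly_Mapping.keys"
abbreviation "bvec b \<equiv> Poly_Mapping.single b 1"

interpretation smul: module smul
  by (rule module_smul)

text \<open>The linear map given by the images \<open>H b\<close> of the basis vectors. All chain maps and homotopies
  below are represented by such families \<open>H\<close>, so that they can be chosen basis vector by basis
  vector.\<close>

definition lin :: "('b \<Rightarrow> ('c \<Rightarrow>\<^sub>0 'a)) \<Rightarrow> ('b \<Rightarrow>\<^sub>0 'a) \<Rightarrow> ('c \<Rightarrow>\<^sub>0 'a::comm_ring_1)" where
  "lin H v = (\<Sum>b\<in>supp v. smul (lk v b) (H b))"

lemma lin_superset:
  assumes "finite A" "supp v \<subseteq> A"
  shows "lin H v = (\<Sum>b\<in>A. smul (lk v b) (H b))"
  unfolding lin_def using assms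
  by (intro sum.mono_neutral_left) (auto simp: in_keys_iff)

lemma lin_zero [simp]: "lin H 0 = 0"
  by (simp add: lin_def)

lemma lin_add: "lin H (v + w) = lin H v + lin H w"
proof -
  let ?A = "supp v \<union> supp w"
  have "lin H (v + w) = (\<Sum>b\<in>?A. smul (lk (v + w) b) (H b))"
    by (rule lin_superset) (use Poly_Mapping.keys_add[of v w] in auto)
  also have "\<dots> = (\<Sum>b\<in>?A. smul (lk v b) (H b)) + (\<Sum>b\<in>?A. smul (lk w b) (H b))"
    by (simp add: lookup_add smul.scale_left_distrib sum.distrib)
  also have "\<dots> = lin H v + lin H w"
    by (simp add: lin_superset[symmetric])
  finally show ?thesis .
qed

lemma keys_smul: "supp (smul c v) \<subseteq> supp v"
  by (auto simp: in_keys_iff lookup_smul)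

lemma lin_smul: "lin H (smul c v) = smul c (lin H v)"
proof -
  have "lin H (smul c v) = (\<Sum>b\<in>supp v. smul (lk (smul c v) b) (H b))"
    by (rule lin_superset[OF finite_keys keys_smul])
  then show ?thesis
    by (simp add: lookup_smul smul.scale_sum_right lin_def)
qed

lemma lin_single: "lin H (Poly_Mapping.single b c) = smul c (H b)"
  by (simp add: lin_def)

lemma lin_bvec: "lin H (bvec b) = H b"
  by (simp add: lin_single)

lemma lin_sum: "lin H (\<Sum>i\<in>A. f i) = (\<Sum>i\<in>A. lin H (f i))"
  by (induction A rule: infinite_finite_induct) (auto simp: lin_add)

lemma lin_cong: "(\<And>b. b \<in> supp v \<Longrightarrow> H b = K b) \<Longrightarrow> lin H v = lin K v"
  by (simp add: lin_def)

lemma lin_fun_diff: "lin (\<lambda>b. H b - K b) v = lin H v - lin K v"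
  by (simp add: lin_def sum_subtractf smul.scale_right_diff_distrib)

lemma lin_scaled: "lin (\<lambda>b. smul c (H b)) v = smul c (lin H v)"
  by (simp add: lin_def smul.scale_sum_right mult.commute)

lemma smul_single: "smul c (Poly_Mapping.single b x) = Poly_Mapping.single b (c * x)"
  by (rule poly_mapping_eqI) (simp add: lookup_smul lookup_single when_def)

lemma lookup_lin: "lk (lin H v) b' = (\<Sum>b\<in>supp v. lk v b * lk (H b) b')"
  by (simp add: lin_def lookup_sum lookup_smul)

lemma lin_bvecs: "lin bvec v = v"
proof (rule poly_mapping_eqI)
  fix b
  have "lk (lin bvec v) b = (\<Sum>b'\<in>supp v. if b' = b then lk v b' else 0)"
    unfolding lookup_lin by (intro sum.cong) (auto simp: lookup_single when_def)
  also have "\<dots> = lk v b"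
    by (simp add: in_keys_iff)
  finally show "lk (lin bvec v) b = lk v b" .
qed

text \<open>A linear map on a free module is determined by the images of the basis vectors.\<close>

lemma module_hom_eq_lin:
  assumes "module_hom smul smul f"
  shows "f v = lin (\<lambda>b. f (bvec b)) v"
proof -
  interpret module_hom smul smul f by fact
  have "f v = f (lin bvec v)" by (simp add: lin_bvecs)
  also have "\<dots> = lin (\<lambda>b. f (bvec b)) v"
    unfolding lin_def by (simp add: sum scale)
  finally show ?thesis .
qed

lemma lin_lin: "lin K (lin H v) = lin (\<lambda>b. lin K (H b)) v"
  unfolding lin_def[of H] lin_def[of "\<lambda>b. lin K (H b)"]
  by (simp add: lin_sum lin_smul)

lemma free_mod_zero [simp]: "0 \<in> free_mod B"
  by (simp add: free_mod_def)

lemma free_mod_add: "v \<in> free_mod B \<Longrightarrow> w \<in> free_mod B \<Longrightarrow> v + w \<in> free_mod B"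
  using Poly_Mapping.keys_add[of v w] by (auto simp: free_mod_def)

lemma free_mod_smul: "v \<in> free_mod B \<Longrightarrow> smul c v \<in> free_mod B"
  using keys_smul[of c v] by (auto simp: free_mod_def)

lemma free_mod_diff:
  "v \<in> free_mod B \<Longrightarrow> w \<in> free_mod B \<Longrightarrow> v - (w :: 'b \<Rightarrow>\<^sub>0 'a::comm_ring_1) \<in> free_mod B"
  by (auto simp: free_mod_def in_keys_iff lookup_minus subset_iff)
    (metis diff_zero)

lemma free_mod_sum: "(\<And>i. i \<in> A \<Longrightarrow> f i \<in> free_mod B) \<Longrightarrow> (\<Sum>i\<in>A. f i) \<in> free_mod B"
  by (induction A rule: infinite_finite_induct) (auto intro: free_mod_add)

lemma free_mod_lin:
  "v \<in> free_mod B \<Longrightarrow> (\<And>b. b \<in> B \<Longrightarrow> H b \<in> free_mod C) \<Longrightarrow> lin H v \<in> free_mod C"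
  unfolding lin_def by (intro free_mod_sum free_mod_smul) (auto simp: free_mod_def)

lemma bvec_free_mod: "b \<in> B \<Longrightarrow> bvec b \<in> free_mod B"
  by (auto simp: free_mod_def)

lemma free_modD: "v \<in> free_mod B \<Longrightarrow> b \<in> supp v \<Longrightarrow> b \<in> B"
  by (auto simp: free_mod_def)

section \<open>Homogeneous parts\<close>

lemma keys_mult_elim:
  assumes "m \<in> supp (f * g)"
  obtains m1 m2 where "m1 \<in> supp f" "m2 \<in> supp g" "m = m1 + m2"
  using assms Poly_Mapping.keys_mult[of f g] by blast

lemma keys_sum_elim:
  assumes "m \<in> supp (\<Sum>i\<in>A. f i)"
  obtains i where "i \<in> A" "m \<in> supp (f i)"
  using assms Poly_Mapping.keys_sum[of f A] by blast

lemma lookup_keys_lin_elim: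
  assumes "m \<in> supp (lk (lin H v) b')"
  obtains b m1 m2 where "b \<in> supp v" "m1 \<in> supp (lk v b)" "m2 \<in> supp (lk (H b) b')"
    "m = m1 + m2"
  using assms unfolding lookup_lin
  by (elim keys_sum_elim keys_mult_elim) blast

lemma keys_lookup_nonempty: "b \<in> supp v \<Longrightarrow> \<exists>m. m \<in> supp (lk v b)"
  by (metis in_keys_iff keys_eq_empty ex_in_conv)

definition hpart where
  "hpart deg s g v = (\<Sum>b\<in>supp v. \<Sum>m\<in>supp (lk v b).
     if s b + deg m = g then Poly_Mapping.single b (Poly_Mapping.single m (lk (lk v b) m)) else 0)"

lemma lookup_hpart:
  "lk (lk (hpart deg s g v) b) m = (if s b + deg m = g then lk (lk v b) m else 0)"
proof -
  have "lk (lk (hpart deg s g v) b) m = (\<Sum>b'\<in>supp v. \<Sum>m'\<in>supp (lk v b').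
     if b' = b \<and> m' = m then (if s b + deg m = g then lk (lk v b) m else 0) else 0)"
    unfolding hpart_def lookup_sum
    by (intro sum.cong) (auto simp: lookup_single when_def)
  also have "\<dots> = (\<Sum>b'\<in>supp v. if b' = b then (\<Sum>m'\<in>supp (lk v b).
     if m' = m then (if s b + deg m = g then lk (lk v b) m else 0) else 0) else 0)"
    by (intro sum.cong) auto
  also have "\<dots> = (if s b + deg m = g then lk (lk v b) m else 0)"
    by (auto simp: in_keys_iff)
  finally show ?thesis .
qed

lemma vec_eqI: "(\<And>b m. lk (lk v b) m = lk (lk w b) m) \<Longrightarrow> v = w"
  by (intro poly_mapping_eqI)

lemma homogeneous_vec_iff:
  "homogeneous_vec deg s g v \<longleftrightarrow> (\<forall>b m. lk (lk v b) m \<noteq> 0 \<longrightarrow> s b + deg m = g)"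
  unfolding homogeneous_vec_def
  by (metis in_keys_iff lookup_zero)

lemma homogeneous_hpart: "homogeneous_vec deg s g (hpart deg s g v)"
  by (auto simp: homogeneous_vec_iff lookup_hpart)

lemma hpart_homogeneous: "homogeneous_vec deg s g v \<Longrightarrow> hpart deg s g v = v"
  by (intro vec_eqI) (auto simp: homogeneous_vec_iff lookup_hpart)

lemma hpart_homogeneous_neq:
  "homogeneous_vec deg s g v \<Longrightarrow> g \<noteq> g' \<Longrightarrow> hpart deg s g' v = 0"
  by (intro vec_eqI) (auto simp: homogeneous_vec_iff lookup_hpart)

lemma hpart_add: "hpart deg s g (v + w) = hpart deg s g v + hpart deg s g w"
  by (intro vec_eqI) (auto simp: lookup_hpart lookup_add)

lemma hpart_zero [simp]: "hpart deg s g 0 = 0"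
  by (intro vec_eqI) (auto simp: lookup_hpart)

lemma hpart_sum: "hpart deg s g (\<Sum>i\<in>A. f i) = (\<Sum>i\<in>A. hpart deg s g (f i))"
  by (induction A rule: infinite_finite_induct) (auto simp: hpart_add)

lemma hpart_free_mod: "v \<in> free_mod B \<Longrightarrow> hpart deg s g v \<in> free_mod B"
proof -
  have "lk (hpart deg s g v) b = 0" if "lk v b = 0" for b
    by (rule poly_mapping_eqI) (simp add: lookup_hpart that)
  then show "v \<in> free_mod B \<Longrightarrow> hpart deg s g v \<in> free_mod B"
    by (auto simp: free_mod_def in_keys_iff subset_iff)
qed

lemma homogeneous_vec_zero [simp]: "homogeneous_vec deg s g 0"
  by (simp add: homogeneous_vec_def)

lemma homogeneous_vec_add:
  "homogeneous_vec deg s g v \<Longrightarrow> homogeneous_vec deg s g w \<Longrightarrow> homogeneous_vec deg s g (v + w)"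
  unfolding homogeneous_vec_iff by (metis lookup_add add_0)

lemma homogeneous_vec_diff:
  "homogeneous_vec deg s g v \<Longrightarrow> homogeneous_vec deg s g w \<Longrightarrow>
     homogeneous_vec deg s g (v - (w :: 'b \<Rightarrow>\<^sub>0 ('x, 'k::comm_ring_1) mpoly))"
  unfolding homogeneous_vec_iff by (metis lookup_minus diff_zero)

text \<open>Every vector is the sum of its terms, so additive properties may be checked on terms.\<close>

lemma term_induct [consumes 1, case_names zero add trm]:
  fixes v :: "'b \<Rightarrow>\<^sub>0 ('x, 'k::comm_ring_1) mpoly"
  assumes v: "v \<in> free_mod B"
    and zero: "P 0"
    and add: "\<And>u w. u \<in> free_mod B \<Longrightarrow> w \<in> free_mod B \<Longrightarrow> P u \<Longrightarrow> P w \<Longrightarrow> P (u + w)"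
    and trm: "\<And>b m c. b \<in> B \<Longrightarrow> P (Poly_Mapping.single b (Poly_Mapping.single m c))"
  shows "P v"
proof -
  have sums: "(\<Sum>i\<in>A. f i) \<in> free_mod B \<and> P (\<Sum>i\<in>A. f i)"
    if "\<And>i. i \<in> A \<Longrightarrow> f i \<in> free_mod B \<and> P (f i)"
    for A :: "('x \<Rightarrow>\<^sub>0 nat) set" and f
    using that by (induction A rule: infinite_finite_induct) (auto intro: add zero free_mod_add)
  have sums': "(\<Sum>i\<in>A. f i) \<in> free_mod B \<and> P (\<Sum>i\<in>A. f i)"
    if "\<And>i. i \<in> A \<Longrightarrow> f i \<in> free_mod B \<and> P (f i)" for A :: "'b set" and f
    using that by (induction A rule: infinite_finite_induct) (auto intro: add zero free_mod_add)
  have "v = hpart (\<lambda>_. 0::nat) (\<lambda>_. 0) 0 v"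
    by (intro vec_eqI) (simp add: lookup_hpart)
  also have "\<dots> = (\<Sum>b\<in>supp v. \<Sum>m\<in>supp (lk v b).
      Poly_Mapping.single b (Poly_Mapping.single m (lk (lk v b) m)))"
    by (simp add: hpart_def)
  finally have eq: "v = \<dots>" .
  show ?thesis
    by (subst eq, rule conjunct2[OF sums'], rule sums)
      (use v in \<open>auto simp: free_mod_def intro: trm zero\<close>)
qed

section \<open>Gradings\<close>

locale grading =
  fixes deg :: "('x \<Rightarrow>\<^sub>0 nat) \<Rightarrow> 'g::cancel_comm_monoid_add"
  assumes deg_add: "deg (m + m') = deg m + deg m'"
begin

lemma homogeneous_vec_smul:
  assumes "homogeneous deg e f" "homogeneous_vec deg s g v"
  shows "homogeneous_vec deg s (g + e) (smul f v)"
  unfolding homogeneous_vec_def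
proof (intro ballI)
  fix b m assume b: "b \<in> supp (smul f v)" and m_in: "m \<in> supp (lk (smul f v) b)"
  obtain m1 m2 where m: "m1 \<in> supp f" "m2 \<in> supp (lk v b)" "m = m1 + m2"
    using m_in unfolding lookup_smul by (rule keys_mult_elim)
  have "b \<in> supp v" using b keys_smul[of f v] by auto
  then have "s b + deg m2 = g" "deg m1 = e"
    using assms m by (auto simp: homogeneous_def homogeneous_vec_def)
  then show "s b + deg m = g + e"
    by (auto simp: m deg_add add_ac)
qed

lemma homogeneous_vec_lin:
  assumes "homogeneous_vec deg s g v"
    and "\<And>b. b \<in> supp v \<Longrightarrow> homogeneous_vec deg t (s b + e) (H b)"
  shows "homogeneous_vec deg t (g + e) (lin H v)"
  unfolding homogeneous_vec_def
proof (intro ballI)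
  fix b' m assume "m \<in> supp (lk (lin H v) b')"
  then obtain b m1 m2 where m: "b \<in> supp v" "m1 \<in> supp (lk v b)" "m2 \<in> supp (lk (H b) b')"
    "m = m1 + m2"
    by (rule lookup_keys_lin_elim)
  then have "b' \<in> supp (H b)"
    by (auto simp: in_keys_iff)
  then have "t b' + deg m2 = s b + e" "s b + deg m1 = g"
    using assms m by (auto simp: homogeneous_vec_def)
  moreover have "t b' + deg m = deg m1 + (t b' + deg m2)"
    by (simp add: m deg_add add_ac)
  ultimately show "t b' + deg m = g + e"
    by (simp add: add_ac)
qed

text \<open>Cancellation of degrees is essential: the remainder \<open>v - hpart deg s g v\<close> has no
  term of degree \<open>g\<close>, and multiplying by a homogeneous polynomial cannot move a term of another
  degree into degree \<open>g + e\<close>.\<close>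

lemma hpart_smul:
  fixes v :: "'b \<Rightarrow>\<^sub>0 ('x, 'k::comm_ring_1) mpoly"
  assumes "homogeneous deg e f"
  shows "hpart deg s (g + e) (smul f v) = smul f (hpart deg s g v)"
proof -
  let ?u = "hpart deg s g v"
  have "hpart deg s (g + e) (smul f (v - ?u)) = 0"
  proof (intro vec_eqI)
    fix b m
    have False if eq: "s b + deg m = g + e" and mem: "m \<in> supp (lk (smul f (v - ?u)) b)"
    proof -
      obtain m1 m2 where m: "m1 \<in> supp f" "m2 \<in> supp (lk (v - ?u) b)" "m = m1 + m2"
        using mem unfolding lookup_smul by (rule keys_mult_elim)
      then have "s b + deg m2 \<noteq> g"
        by (auto simp: in_keys_iff lookup_minus lookup_hpart)
      moreover have "deg m1 = e"
        using m(1) assms by (simp add: homogeneous_def)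
      moreover have "s b + deg m = (s b + deg m2) + deg m1"
        by (simp add: m deg_add add_ac)
      ultimately show False
        using eq by simp
    qed
    then show "lk (lk (hpart deg s (g + e) (smul f (v - ?u))) b) m = lk (lk 0 b) m"
      by (auto simp: lookup_hpart in_keys_iff)
  qed
  moreover have "hpart deg s (g + e) (smul f ?u) = smul f ?u"
    by (intro hpart_homogeneous homogeneous_vec_smul assms homogeneous_hpart)
  ultimately show ?thesis
    using hpart_add[of deg s "g + e" "smul f (v - ?u)" "smul f ?u"]
    by (simp add: smul.scale_right_distrib[symmetric])
qed

text \<open>The degree-0 part of a family \<open>K\<close> that need not respect the degrees: on a homogeneous vector
  it computes the homogeneous part of the image. This turns a chain map that respects only the
  total degree into one that respects the multidegree.\<close>

lemma hpart_lin:
  fixes v :: "'b \<Rightarrow>\<^sub>0 ('x, 'k::comm_ring_1) mpoly"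
  assumes "homogeneous_vec deg s g v"
  shows "hpart deg t g (lin K v) = lin (\<lambda>b. hpart deg t (s b) (K b)) v"
proof -
  have "hpart deg t g (smul (lk v b) (K b)) = smul (lk v b) (hpart deg t (s b) (K b))"
    if b: "b \<in> supp v" for b
  proof -
    obtain m where m: "m \<in> supp (lk v b)"
      using keys_lookup_nonempty[OF b] by blast
    have "s b + deg m' = s b + deg m" if "m' \<in> supp (lk v b)" for m'
      using assms b m that by (simp add: homogeneous_vec_def)
    then have "homogeneous deg (deg m) (lk v b)"
      by (simp add: homogeneous_def)
    moreover have "g = s b + deg m"
      using assms b m by (simp add: homogeneous_vec_def)
    ultimately show ?thesis
      by (simp add: hpart_smul)
  qed
  then show ?thesis
    by (simp add: lin_def hpart_sum)
qed

lemma homogeneous_single: "homogeneous deg (deg m) (Poly_Mapping.single m c)"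
  by (auto simp: homogeneous_def in_keys_iff lookup_single when_def)

lemma hpart_map_lin:
  fixes v :: "'b \<Rightarrow>\<^sub>0 ('x, 'k::comm_ring_1) mpoly"
  assumes "v \<in> free_mod B"
    and H: "\<And>b. b \<in> B \<Longrightarrow> homogeneous_vec deg t (s b) (H b)"
  shows "lin H (hpart deg s g v) = hpart deg t g (lin H v)"
  using assms(1)
proof (induction v rule: term_induct)
  case zero
  then show ?case by simp
next
  case (add u w)
  then show ?case by (simp add: hpart_add lin_add)
next
  case (trm b m c)
  let ?u = "Poly_Mapping.single b (Poly_Mapping.single m c)"
  have 1: "homogeneous_vec deg s (s b + deg m) ?u"
    by (auto simp: homogeneous_vec_iff lookup_single when_def)
  have 2: "homogeneous_vec deg t (s b + deg m) (lin H ?u)"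
    unfolding lin_single by (intro homogeneous_vec_smul homogeneous_single H trm)
  show ?case
  proof (cases "g = s b + deg m")
    case True
    then show ?thesis using 1 2 by (simp add: hpart_homogeneous)
  next
    case False
    then show ?thesis using 1 2 by (simp add: hpart_homogeneous_neq)
  qed
qed

lemma deg_zero: "deg 0 = 0"
  using deg_add[of 0 0] by simp

lemma homogeneous_vec_bvec: "homogeneous_vec deg s (s b) (bvec b)"
  by (auto simp: homogeneous_vec_iff lookup_single when_def lookup_one deg_zero)

end

section \<open>Graded free resolutions\<close>

text \<open>The working form of a resolution of \<open>S/I\<close>. Compatibility of the differential with the degrees
  is required on basis vectors only. In this form it passes at once to every coarser grading.\<close>

locale graded_resolution = grading deg
  for deg :: "('x \<Rightarrow>\<^sub>0 nat) \<Rightarrow> 'g::cancel_comm_monoid_add" +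
  fixes B :: "nat \<Rightarrow> 'b set"
    and s :: "nat \<Rightarrow> 'b \<Rightarrow> 'g"
    and D :: "nat \<Rightarrow> ('b \<Rightarrow>\<^sub>0 ('x, 'k::field) mpoly) \<Rightarrow> ('b \<Rightarrow>\<^sub>0 ('x, 'k) mpoly)"
    and I :: "('x, 'k) mpoly set"
    and b0 :: 'b
  assumes D_hom: "module_hom smul smul (D (Suc p))"
    and D_free: "v \<in> free_mod (B (Suc p)) \<Longrightarrow> D (Suc p) v \<in> free_mod (B p)"
    and D_bvec_homogeneous:
      "b \<in> B (Suc p) \<Longrightarrow> homogeneous_vec deg (s p) (s (Suc p) b) (D (Suc p) (bvec b))"
    and exact: "{v \<in> free_mod (B (Suc p)). D (Suc p) v = 0} = D (Suc (Suc p)) ` free_mod (B (Suc (Suc p)))"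
    and B_0: "B 0 = {b0}"
    and s_0: "s 0 b0 = 0"
    and image_D1: "D (Suc 0) ` free_mod (B (Suc 0)) = Poly_Mapping.single b0 ` I"
begin

text \<open>The image of \<open>F\<^sub>p\<^sub>+\<^sub>1\<close> in \<open>F\<^sub>p\<close>. It is the copy of \<open>I\<close> in \<open>F\<^sub>0\<close> for \<open>p = 0\<close> and the kernel of the differential for
  \<open>p > 0\<close>, so that lifting arguments need not treat the end of the complex separately.\<close>

definition bdry :: "nat \<Rightarrow> ('b \<Rightarrow>\<^sub>0 ('x, 'k) mpoly) set" where
  "bdry p = D (Suc p) ` free_mod (B (Suc p))"

lemma bdry_0: "bdry 0 = Poly_Mapping.single b0 ` I"
  by (simp add: bdry_def image_D1)

lemma bdry_Suc: "v \<in> bdry (Suc p) \<longleftrightarrow> v \<in> free_mod (B (Suc p)) \<and> D (Suc p) v = 0"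
  using exact[of p] by (auto simp: bdry_def)

lemma bdry_free: "v \<in> bdry p \<Longrightarrow> v \<in> free_mod (B p)"
  by (auto simp: bdry_def D_free)

lemma D_bdry: "v \<in> free_mod (B (Suc p)) \<Longrightarrow> D (Suc p) v \<in> bdry p"
  by (auto simp: bdry_def)

lemma D_D: "v \<in> free_mod (B (Suc (Suc p))) \<Longrightarrow> D (Suc p) (D (Suc (Suc p)) v) = 0"
  using D_bdry[of v "Suc p"] by (simp add: bdry_Suc)

lemma D_lin: "D (Suc p) v = lin (\<lambda>b. D (Suc p) (bvec b)) v"
  by (rule module_hom_eq_lin[OF D_hom])

lemma D_diff: "D (Suc p) (v - w) = D (Suc p) v - D (Suc p) w"
  by (rule module_hom.diff[OF D_hom])

lemma D_smul: "D (Suc p) (smul c v) = smul c (D (Suc p) v)"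
  by (rule module_hom.scale[OF D_hom])

lemma zero_bdry: "0 \<in> bdry p"
  using D_bdry[of 0 p] D_diff[of p 0 0] by simp

lemma D_lin_comp: "D (Suc p) (lin H v) = lin (\<lambda>b. D (Suc p) (H b)) v"
  unfolding D_lin[of p "lin H v"] lin_lin by (simp add: D_lin[symmetric])

lemma D_hpart:
  assumes "v \<in> free_mod (B (Suc p))"
  shows "D (Suc p) (hpart deg (s (Suc p)) g v) = hpart deg (s p) g (D (Suc p) v)"
  unfolding D_lin[of p "hpart deg (s (Suc p)) g v"] D_lin[of p v]
  by (rule hpart_map_lin[OF assms D_bvec_homogeneous])

lemma homogeneous_lift:
  assumes "w \<in> bdry p" "homogeneous_vec deg (s p) g w"
  shows "\<exists>v\<in>free_mod (B (Suc p)). homogeneous_vec deg (s (Suc p)) g v \<and> D (Suc p) v = w"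
proof -
  obtain v where v: "v \<in> free_mod (B (Suc p))" "w = D (Suc p) v"
    using assms(1) by (auto simp: bdry_def)
  then show ?thesis
    using assms(2)
    by (intro bexI[of _ "hpart deg (s (Suc p)) g v"])
      (auto simp: D_hpart hpart_homogeneous homogeneous_hpart hpart_free_mod)
qed

text \<open>A chain endomorphism of degree \<open>e\<close> that is zero on \<open>S/I\<close> is homotopic to zero. The homotopy is
  built recursively. The invariant says that \<open>D h = \<theta>\<close> holds on boundaries, which is what makes
  \<open>\<theta> b - h (D b)\<close> liftable in the next step.\<close>

lemma null_homotopy:
  assumes th_free: "\<And>p b. b \<in> B p \<Longrightarrow> \<theta> p b \<in> free_mod (B p)"
    and th_hom: "\<And>p b. b \<in> B p \<Longrightarrow> homogeneous_vec deg (s p) (s p b + e) (\<theta> p b)"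
    and th_chain: "\<And>p b. b \<in> B (Suc p) \<Longrightarrow>
      D (Suc p) (\<theta> (Suc p) b) = lin (\<theta> p) (D (Suc p) (bvec b))"
    and th_0: "\<theta> 0 b0 \<in> bdry 0"
  obtains h where "\<And>p b. b \<in> B p \<Longrightarrow> h p b \<in> free_mod (B (Suc p))"
    and "\<And>p b. b \<in> B p \<Longrightarrow> homogeneous_vec deg (s (Suc p)) (s p b + e) (h p b)"
    and "\<theta> 0 b0 = D (Suc 0) (h 0 b0)"
    and "\<And>p b. b \<in> B (Suc p) \<Longrightarrow>
      \<theta> (Suc p) b = D (Suc (Suc p)) (h (Suc p) b) + lin (h p) (D (Suc p) (bvec b))"
proof -
  define P where "P p h \<longleftrightarrow>
    (\<forall>b\<in>B p. h b \<in> free_mod (B (Suc p)) \<and> homogeneous_vec deg (s (Suc p)) (s p b + e) (h b)) \<and>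
    (p = 0 \<longrightarrow> \<theta> 0 b0 = D (Suc 0) (h b0)) \<and>
    (\<forall>w\<in>bdry p. D (Suc p) (lin h w) = lin (\<theta> p) w)" for p h
  define Q where "Q p h h' \<longleftrightarrow> (\<forall>b\<in>B (Suc p).
      \<theta> (Suc p) b = D (Suc (Suc p)) (h' b) + lin h (D (Suc p) (bvec b)))" for p h h'
  have "\<exists>h. P 0 h"
  proof -
    obtain v where v: "v \<in> free_mod (B (Suc 0))"
      "homogeneous_vec deg (s (Suc 0)) (s 0 b0 + e) v" "D (Suc 0) v = \<theta> 0 b0"
      using homogeneous_lift[OF th_0 th_hom] B_0 by auto
    have "D (Suc 0) (lin (\<lambda>_. v) w) = lin (\<theta> 0) w" if "w \<in> bdry 0" for w
      unfolding D_lin_comp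
      by (rule lin_cong) (use bdry_free[OF that] v in \<open>auto simp: free_mod_def B_0\<close>)
    then show ?thesis
      using v by (intro exI[of _ "\<lambda>_. v"]) (auto simp: P_def B_0)
  qed
  moreover have "\<exists>h'. P (Suc p) h' \<and> Q p h h'" if Ph: "P p h" for p h
  proof -
    have ex: "\<exists>v\<in>free_mod (B (Suc (Suc p))).
        homogeneous_vec deg (s (Suc (Suc p))) (s (Suc p) b + e) v
        \<and> D (Suc (Suc p)) v = \<theta> (Suc p) b - lin h (D (Suc p) (bvec b))"
      if b: "b \<in> B (Suc p)" for b
    proof (rule homogeneous_lift)
      let ?u = "D (Suc p) (bvec b)"
      have u: "?u \<in> bdry p" "?u \<in> free_mod (B p)" "homogeneous_vec deg (s p) (s (Suc p) b) ?u"
        using b by (auto intro!: D_bdry D_free D_bvec_homogeneous bvec_free_mod)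
      have "lin h ?u \<in> free_mod (B (Suc p))"
        using Ph u(2) by (auto simp: P_def intro!: free_mod_lin)
      then show "\<theta> (Suc p) b - lin h ?u \<in> bdry (Suc p)"
        unfolding bdry_Suc using Ph u b
        by (simp add: free_mod_diff th_free D_diff th_chain P_def)
      have "homogeneous_vec deg (s (Suc p)) (s (Suc p) b + e) (lin h ?u)"
        using Ph u by (intro homogeneous_vec_lin[OF u(3)]) (auto simp: P_def free_modD)
      then show "homogeneous_vec deg (s (Suc p)) (s (Suc p) b + e) (\<theta> (Suc p) b - lin h ?u)"
        by (intro homogeneous_vec_diff th_hom b)
    qed
    obtain h' where h': "\<And>b. b \<in> B (Suc p) \<Longrightarrow> h' b \<in> free_mod (B (Suc (Suc p))) \<and>
        homogeneous_vec deg (s (Suc (Suc p))) (s (Suc p) b + e) (h' b)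
        \<and> D (Suc (Suc p)) (h' b) = \<theta> (Suc p) b - lin h (D (Suc p) (bvec b))"
      using ex by metis
    have "D (Suc (Suc p)) (lin h' w) = lin (\<theta> (Suc p)) w" if w: "w \<in> bdry (Suc p)" for w
    proof -
      have "D (Suc (Suc p)) (lin h' w)
          = lin (\<lambda>b. \<theta> (Suc p) b - lin h (D (Suc p) (bvec b))) w"
        unfolding D_lin_comp
        by (rule lin_cong) (use bdry_free[OF w] h' in \<open>auto simp: free_mod_def\<close>)
      also have "\<dots> = lin (\<theta> (Suc p)) w - lin h (D (Suc p) w)"
        by (simp add: lin_fun_diff lin_lin[symmetric] D_lin[symmetric])
      finally show ?thesis
        using w by (simp add: bdry_Suc)
    qed
    then show ?thesis
      using h' by (intro exI[of _ h']) (auto simp: P_def Q_def)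
  qed
  ultimately obtain h where h: "\<And>p. P p (h p)" "\<And>p. Q p (h p) (h (Suc p))"
    using dependent_nat_choice[of P Q] by blast
  show ?thesis
  proof (rule that[of h])
    show "\<theta> 0 b0 = D (Suc 0) (h 0 b0)"
      using h(1)[of 0] by (simp add: P_def)
  qed (use h in \<open>auto simp: P_def Q_def\<close>)
qed

end

text \<open>The usual lift of the identity of \<open>S/I\<close> to a map between two resolutions.\<close>

lemma comparison_map:
  assumes "graded_resolution deg B s D I b0" and "graded_resolution deg B' s' D' I b0'"
  obtains \<alpha> where "\<alpha> 0 b0 = bvec b0'"
    and "\<And>p b. b \<in> B p \<Longrightarrow> \<alpha> p b \<in> free_mod (B' p)"
    and "\<And>p b. b \<in> B p \<Longrightarrow> homogeneous_vec deg (s' p) (s p b) (\<alpha> p b)"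
    and "\<And>p b. b \<in> B (Suc p) \<Longrightarrow> D' (Suc p) (\<alpha> (Suc p) b) = lin (\<alpha> p) (D (Suc p) (bvec b))"
proof -
  interpret F: graded_resolution deg B s D I b0 by fact
  interpret G: graded_resolution deg B' s' D' I b0' by fact
  define P where "P p h \<longleftrightarrow>
    (\<forall>b\<in>B p. h b \<in> free_mod (B' p) \<and> homogeneous_vec deg (s' p) (s p b) (h b)) \<and>
    (p = 0 \<longrightarrow> h b0 = bvec b0') \<and> (\<forall>w\<in>F.bdry p. lin h w \<in> G.bdry p)" for p h
  define Q where "Q p h h' \<longleftrightarrow> (\<forall>b\<in>B (Suc p).
      D' (Suc p) (h' b) = lin h (D (Suc p) (bvec b)))" for p h h'
  have "P 0 (\<lambda>_. bvec b0')"
    using F.homogeneous_vec_bvec[of "s' 0" b0']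
    by (auto simp: P_def F.B_0 G.B_0 F.s_0 G.s_0 F.bdry_0 G.bdry_0 lin_single smul_single
        bvec_free_mod)
  then have "\<exists>h. P 0 h" by blast
  moreover have "\<exists>h'. P (Suc p) h' \<and> Q p h h'" if Ph: "P p h" for p h
  proof -
    have ex: "\<exists>v\<in>free_mod (B' (Suc p)). homogeneous_vec deg (s' (Suc p)) (s (Suc p) b) v
        \<and> D' (Suc p) v = lin h (D (Suc p) (bvec b))"
      if b: "b \<in> B (Suc p)" for b
    proof (rule G.homogeneous_lift)
      let ?u = "D (Suc p) (bvec b)"
      have u: "?u \<in> F.bdry p" "?u \<in> free_mod (B p)"
        and hu: "homogeneous_vec deg (s p) (s (Suc p) b) ?u"
        using b by (auto intro!: F.D_bdry F.D_free F.D_bvec_homogeneous bvec_free_mod)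
      show "lin h ?u \<in> G.bdry p"
        using u Ph by (auto simp: P_def)
      show "homogeneous_vec deg (s' p) (s (Suc p) b) (lin h ?u)"
        using F.homogeneous_vec_lin[OF hu, of "s' p" 0 h] Ph u(2) by (auto simp: P_def free_modD)
    qed
    obtain h' where h': "\<And>b. b \<in> B (Suc p) \<Longrightarrow> h' b \<in> free_mod (B' (Suc p)) \<and>
        homogeneous_vec deg (s' (Suc p)) (s (Suc p) b) (h' b)
        \<and> D' (Suc p) (h' b) = lin h (D (Suc p) (bvec b))"
      using ex by metis
    have "lin h' w \<in> G.bdry (Suc p)" if w: "w \<in> F.bdry (Suc p)" for w
    proof -
      have "D' (Suc p) (lin h' w) = lin (\<lambda>b. lin h (D (Suc p) (bvec b))) w"
        unfolding G.D_lin_comp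
        by (rule lin_cong) (use F.bdry_free[OF w] h' in \<open>auto simp: free_mod_def\<close>)
      also have "\<dots> = lin h (D (Suc p) w)"
        by (simp add: lin_lin[symmetric] F.D_lin[symmetric])
      finally show ?thesis
        using w h' by (auto simp: G.bdry_Suc F.bdry_Suc intro!: free_mod_lin)
    qed
    then show ?thesis
      using h' by (intro exI[of _ h']) (auto simp: P_def Q_def)
  qed
  ultimately obtain h where h: "\<And>p. P p (h p)" "\<And>p. Q p (h p) (h (Suc p))"
    using dependent_nat_choice[of P Q] by blast
  show ?thesis
  proof (rule that[of h])
    show "h 0 b0 = bvec b0'"
      using h(1)[of 0] by (simp add: P_def)
  qed (use h in \<open>auto simp: P_def Q_def\<close>)
qed

section \<open>Cochains with values in a field\<close>

locale evaluated_resolution = graded_resolution deg B s D I b0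
  for deg :: "('x \<Rightarrow>\<^sub>0 nat) \<Rightarrow> 'g::cancel_comm_monoid_add"
    and B :: "nat \<Rightarrow> 'b set"
    and s :: "nat \<Rightarrow> 'b \<Rightarrow> 'g"
    and D :: "nat \<Rightarrow> ('b \<Rightarrow>\<^sub>0 ('x, 'k::field) mpoly) \<Rightarrow> ('b \<Rightarrow>\<^sub>0 ('x, 'k) mpoly)"
    and I :: "('x, 'k) mpoly set"
    and b0 :: 'b +
  fixes ev :: "('x, 'k) mpoly \<Rightarrow> 'q::field"
  assumes ev_add: "ev (f + g) = ev f + ev g"
    and ev_mult: "ev (f * g) = ev f * ev g"
    and ev_one: "ev 1 = 1"
begin

lemma ev_zero [simp]: "ev 0 = 0"
  using ev_add[of 0 0] by (metis add.right_neutral add_left_cancel)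

text \<open>The value at \<open>v\<close> of the linear map that sends the basis vector \<open>b\<close> to \<open>\<phi> b\<close>, where \<open>S\<close> acts on \<open>Q\<close>
  through \<open>ev\<close>.\<close>

definition pair :: "('b \<Rightarrow> 'q) \<Rightarrow> ('b \<Rightarrow>\<^sub>0 ('x, 'k) mpoly) \<Rightarrow> 'q" where
  "pair \<phi> v = (\<Sum>b\<in>supp v. ev (lk v b) * \<phi> b)"

lemma pair_superset:
  assumes "finite A" "supp v \<subseteq> A"
  shows "pair \<phi> v = (\<Sum>b\<in>A. ev (lk v b) * \<phi> b)"
  unfolding pair_def using assms
  by (intro sum.mono_neutral_left) (auto simp: in_keys_iff)

lemma pair_zero [simp]: "pair \<phi> 0 = 0"
  by (simp add: pair_def)

lemma pair_add: "pair \<phi> (v + w) = pair \<phi> v + pair \<phi> w"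
proof -
  let ?A = "supp v \<union> supp w"
  have "pair \<phi> (v + w) = (\<Sum>b\<in>?A. ev (lk (v + w) b) * \<phi> b)"
    by (rule pair_superset) (use Poly_Mapping.keys_add[of v w] in auto)
  also have "\<dots> = (\<Sum>b\<in>?A. ev (lk v b) * \<phi> b) + (\<Sum>b\<in>?A. ev (lk w b) * \<phi> b)"
    by (simp add: lookup_add ev_add sum.distrib distrib_right)
  also have "\<dots> = pair \<phi> v + pair \<phi> w"
    by (simp add: pair_superset[symmetric])
  finally show ?thesis .
qed

lemma pair_diff: "pair \<phi> (v - w) = pair \<phi> v - pair \<phi> w"
  using pair_add[of \<phi> "v - w" w] by simp

lemma pair_smul: "pair \<phi> (smul c v) = ev c * pair \<phi> v"
proof -
  have "pair \<phi> (smul c v) = (\<Sum>b\<in>supp v. ev (lk (smul c v) b) * \<phi> b)"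
    by (rule pair_superset[OF finite_keys keys_smul])
  then show ?thesis
    by (simp add: lookup_smul ev_mult pair_def sum_distrib_left mult.assoc)
qed

lemma pair_sum: "pair \<phi> (\<Sum>i\<in>A. f i) = (\<Sum>i\<in>A. pair \<phi> (f i))"
  by (induction A rule: infinite_finite_induct) (auto simp: pair_add)

lemma pair_bvec [simp]: "pair \<phi> (bvec b) = \<phi> b"
  by (simp add: pair_def ev_one)

lemma pair_lin: "pair \<phi> (lin H v) = pair (\<lambda>b. pair \<phi> (H b)) v"
  unfolding pair_def[of "\<lambda>b. pair \<phi> (H b)"] by (simp add: lin_def pair_sum pair_smul)

lemma pair_cong: "(\<And>b. b \<in> supp v \<Longrightarrow> \<phi> b = \<psi> b) \<Longrightarrow> pair \<phi> v = pair \<psi> v"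
  by (simp add: pair_def)

lemma pair_eq_zero: "(\<And>b. b \<in> supp v \<Longrightarrow> \<phi> b = 0) \<Longrightarrow> pair \<phi> v = 0"
  by (simp add: pair_def)

lemma pair_fun_add: "pair (\<lambda>b. \<phi> b + \<psi> b) v = pair \<phi> v + pair \<psi> v"
  by (simp add: pair_def distrib_left sum.distrib)

lemma pair_fun_scale: "pair (\<lambda>b. c * \<phi> b) v = c * pair \<phi> v"
  by (simp add: pair_def sum_distrib_left mult.left_commute)

lemma pair_fun_diff: "pair (\<lambda>b. \<phi> b - \<psi> b) v = pair \<phi> v - pair \<psi> v"
  by (simp add: pair_def right_diff_distrib sum_subtractf)

lemma pair_fun_sum: "pair (\<lambda>b. \<Sum>i\<in>A. \<phi> i b) v = (\<Sum>i\<in>A. pair (\<phi> i) v)"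
  by (induction A rule: infinite_finite_induct) (auto simp: pair_fun_add pair_eq_zero)

text \<open>Convexity for the divisibility order, in additive form. It makes the truncated multiplication
  on \<open>N\<^sub>\<Gamma>\<close> associative.\<close>

definition convex_degs :: "'g set \<Rightarrow> bool" where
  "convex_degs \<Gamma> \<longleftrightarrow> (\<forall>u v w. u \<in> \<Gamma> \<longrightarrow> u + v + w \<in> \<Gamma> \<longrightarrow> u + v \<in> \<Gamma>)"

text \<open>Homomorphisms \<open>F\<^sub>p \<rightarrow> N\<^sub>\<Gamma>\<close> of degree 0.\<close>

definition cochain :: "'g set \<Rightarrow> nat \<Rightarrow> ('b \<Rightarrow> 'q) \<Rightarrow> bool" where
  "cochain \<Gamma> p \<phi> \<longleftrightarrow> (\<forall>b. \<phi> b \<noteq> 0 \<longrightarrow> b \<in> B p \<and> s p b \<in> \<Gamma>)"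

definition cobd :: "'g set \<Rightarrow> nat \<Rightarrow> ('b \<Rightarrow> 'q) \<Rightarrow> ('b \<Rightarrow> 'q)" where
  "cobd \<Gamma> p \<phi> = (\<lambda>b. if b \<in> B (Suc p) \<and> s (Suc p) b \<in> \<Gamma> then pair \<phi> (D (Suc p) (bvec b)) else 0)"

definition cocycle :: "'g set \<Rightarrow> nat \<Rightarrow> ('b \<Rightarrow> 'q) \<Rightarrow> bool" where
  "cocycle \<Gamma> p \<phi> \<longleftrightarrow> cochain \<Gamma> p \<phi> \<and> cobd \<Gamma> p \<phi> = (\<lambda>_. 0)"

definition coboundary :: "'g set \<Rightarrow> nat \<Rightarrow> ('b \<Rightarrow> 'q) \<Rightarrow> bool" where
  "coboundary \<Gamma> p \<phi> \<longleftrightarrow>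
     (case p of 0 \<Rightarrow> \<phi> = (\<lambda>_. 0) | Suc q \<Rightarrow> \<exists>\<psi>. cochain \<Gamma> q \<psi> \<and> cobd \<Gamma> q \<psi> = \<phi>)"

definition acyclic_at :: "'g set \<Rightarrow> nat \<Rightarrow> bool" where
  "acyclic_at \<Gamma> p \<longleftrightarrow> (\<forall>\<phi>. cocycle \<Gamma> p \<phi> \<longrightarrow> coboundary \<Gamma> p \<phi>)"

lemma coboundary_0 [simp]: "coboundary \<Gamma> 0 \<phi> \<longleftrightarrow> \<phi> = (\<lambda>_. 0)"
  and coboundary_Suc [simp]:
    "coboundary \<Gamma> (Suc q) \<phi> \<longleftrightarrow> (\<exists>\<psi>. cochain \<Gamma> q \<psi> \<and> cobd \<Gamma> q \<psi> = \<phi>)"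
  by (simp_all add: coboundary_def)

lemma cochain_cobd: "cochain \<Gamma> (Suc p) (cobd \<Gamma> p \<phi>)"
  by (simp add: cochain_def cobd_def)

lemma cochain_diff: "cochain \<Gamma> p \<phi> \<Longrightarrow> cochain \<Gamma> p \<psi> \<Longrightarrow> cochain \<Gamma> p (\<lambda>b. \<phi> b - \<psi> b)"
  unfolding cochain_def by (metis diff_zero)

lemma cochain_add: "cochain \<Gamma> p \<phi> \<Longrightarrow> cochain \<Gamma> p \<psi> \<Longrightarrow> cochain \<Gamma> p (\<lambda>b. \<phi> b + \<psi> b)"
  unfolding cochain_def by (metis add_0)

lemma cochain_scale: "cochain \<Gamma> p \<phi> \<Longrightarrow> cochain \<Gamma> p (\<lambda>b. c * \<phi> b)"
  unfolding cochain_def by auto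

lemma cochain_zero [simp]: "cochain \<Gamma> p (\<lambda>_. 0)"
  by (simp add: cochain_def)

lemma cochain_sum:
  "(\<And>i. i \<in> A \<Longrightarrow> cochain \<Gamma> p (\<phi> i)) \<Longrightarrow> cochain \<Gamma> p (\<lambda>b. \<Sum>i\<in>A. \<phi> i b)"
  by (induction A rule: infinite_finite_induct) (auto simp: cochain_add)

lemma cobd_diff: "cobd \<Gamma> p (\<lambda>b. \<phi> b - \<psi> b) = (\<lambda>b. cobd \<Gamma> p \<phi> b - cobd \<Gamma> p \<psi> b)"
  by (auto simp: cobd_def pair_fun_diff)

lemma cobd_scale: "cobd \<Gamma> p (\<lambda>b. c * \<phi> b) = (\<lambda>b. c * cobd \<Gamma> p \<phi> b)"
  by (auto simp: cobd_def pair_fun_scale)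

lemma cobd_sum: "cobd \<Gamma> p (\<lambda>b. \<Sum>i\<in>A. \<phi> i b) = (\<lambda>b. \<Sum>i\<in>A. cobd \<Gamma> p (\<phi> i) b)"
proof
  fix b show "cobd \<Gamma> p (\<lambda>b. \<Sum>i\<in>A. \<phi> i b) b = (\<Sum>i\<in>A. cobd \<Gamma> p (\<phi> i) b)"
    by (cases "b \<in> B (Suc p) \<and> s (Suc p) b \<in> \<Gamma>") (auto simp: cobd_def pair_fun_sum)
qed

lemma cobd_zero [simp]: "cobd \<Gamma> p (\<lambda>_. 0) = (\<lambda>_. 0)"
  by (auto simp: cobd_def pair_eq_zero)

lemma coboundary_scale: "coboundary \<Gamma> p \<phi> \<Longrightarrow> coboundary \<Gamma> p (\<lambda>b. c * \<phi> b)"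
proof (cases p)
  case (Suc q)
  assume "coboundary \<Gamma> p \<phi>"
  then obtain \<psi> where "cochain \<Gamma> q \<psi>" "cobd \<Gamma> q \<psi> = \<phi>"
    using Suc by auto
  then show ?thesis
    using Suc by (auto simp: cochain_scale cobd_scale intro!: exI[of _ "\<lambda>b. c * \<psi> b"])
qed auto

text \<open>A vector whose degree \<open>u\<close> is not in \<open>\<Gamma>\<close>, but lies below an element of \<open>\<Gamma>\<close>, pairs to zero with
  every cochain on \<open>\<Gamma>\<close>: by convexity no degree below \<open>u\<close> belongs to \<open>\<Gamma>\<close>. Because of this the
  truncation of cochains to \<open>\<Gamma>\<close> is compatible with the differential.\<close>

lemma pair_outside:
  assumes "convex_degs \<Gamma>" "cochain \<Gamma> p \<phi>" "homogeneous_vec deg (s p) u w"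
    and "u + x \<in> \<Gamma>" "u \<notin> \<Gamma>"
  shows "pair \<phi> w = 0"
proof (rule pair_eq_zero)
  fix b assume b: "b \<in> supp w"
  obtain m where "m \<in> supp (lk w b)"
    using keys_lookup_nonempty[OF b] by blast
  then have u: "u = s p b + deg m"
    using assms(3) b by (auto simp: homogeneous_vec_def)
  then have "s p b \<notin> \<Gamma>"
    using assms(1)[unfolded convex_degs_def, rule_format, of "s p b" "deg m" x] assms(4,5)
    by auto
  then show "\<phi> b = 0"
    using assms(2) by (auto simp: cochain_def)
qed

lemma pair_D:
  assumes "convex_degs \<Gamma>" "cochain \<Gamma> p \<phi>"
    and v: "v \<in> free_mod (B (Suc p))" "homogeneous_vec deg (s (Suc p)) u v" and "u \<in> \<Gamma>"
  shows "pair \<phi> (D (Suc p) v) = pair (cobd \<Gamma> p \<phi>) v"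
proof -
  have "pair \<phi> (D (Suc p) v) = pair (\<lambda>b. pair \<phi> (D (Suc p) (bvec b))) v"
    by (subst D_lin) (rule pair_lin)
  also have "\<dots> = pair (cobd \<Gamma> p \<phi>) v"
  proof (rule pair_cong)
    fix b assume b: "b \<in> supp v"
    obtain m where "m \<in> supp (lk v b)"
      using keys_lookup_nonempty[OF b] by blast
    then have m: "s (Suc p) b + deg m \<in> \<Gamma>"
      using v(2) b \<open>u \<in> \<Gamma>\<close> by (auto simp: homogeneous_vec_def)
    have bB: "b \<in> B (Suc p)"
      using v(1) b by (rule free_modD)
    show "pair \<phi> (D (Suc p) (bvec b)) = cobd \<Gamma> p \<phi> b"
      using bB pair_outside[OF assms(1,2) D_bvec_homogeneous[OF bB] m]
      by (auto simp: cobd_def)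
  qed
  finally show ?thesis .
qed

lemma cobd_cobd:
  assumes "convex_degs \<Gamma>" "cochain \<Gamma> p \<phi>"
  shows "cobd \<Gamma> (Suc p) (cobd \<Gamma> p \<phi>) = (\<lambda>_. 0)"
proof
  fix b
  show "cobd \<Gamma> (Suc p) (cobd \<Gamma> p \<phi>) b = 0"
  proof (cases "b \<in> B (Suc (Suc p)) \<and> s (Suc (Suc p)) b \<in> \<Gamma>")
    case True
    then have "pair (cobd \<Gamma> p \<phi>) (D (Suc (Suc p)) (bvec b))
        = pair \<phi> (D (Suc p) (D (Suc (Suc p)) (bvec b)))"
      using assms
      by (intro pair_D[symmetric, where u = "s (Suc (Suc p)) b"])
        (auto intro: D_free D_bvec_homogeneous bvec_free_mod)
    then show ?thesis
      using True by (simp add: cobd_def D_D bvec_free_mod)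
  next
    case False
    then show ?thesis
      unfolding cobd_def[of \<Gamma> "Suc p"] by auto
  qed
qed

text \<open>If \<open>\<theta> = D h + h D\<close> and \<open>\<phi>\<close> is a cocycle, then \<open>\<phi> \<theta> = \<phi> h D\<close> is the coboundary of \<open>\<phi> h\<close>. Since
  \<open>\<theta>\<close> has degree \<open>e\<close>, the composite is a cochain on \<open>\<Gamma>\<close> after identifying \<open>\<Gamma>\<close> with its
  translate by \<open>e\<close>.\<close>

lemma null_homotopic_coboundary:
  assumes \<Gamma>: "convex_degs \<Gamma>" "\<And>c. c \<in> \<Gamma> \<longleftrightarrow> c + e \<in> \<Gamma>"
    and \<phi>: "cocycle \<Gamma> p \<phi>"
    and th_free: "\<And>p b. b \<in> B p \<Longrightarrow> \<theta> p b \<in> free_mod (B p)"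
    and th_hom: "\<And>p b. b \<in> B p \<Longrightarrow> homogeneous_vec deg (s p) (s p b + e) (\<theta> p b)"
    and th_chain: "\<And>p b. b \<in> B (Suc p) \<Longrightarrow>
      D (Suc p) (\<theta> (Suc p) b) = lin (\<theta> p) (D (Suc p) (bvec b))"
    and th_0: "\<theta> 0 b0 \<in> bdry 0"
  shows "coboundary \<Gamma> p (\<lambda>b. if b \<in> B p \<and> s p b \<in> \<Gamma> then pair \<phi> (\<theta> p b) else 0)"
proof -
  obtain h where h_free: "\<And>p b. b \<in> B p \<Longrightarrow> h p b \<in> free_mod (B (Suc p))"
    and h_hom: "\<And>p b. b \<in> B p \<Longrightarrow> homogeneous_vec deg (s (Suc p)) (s p b + e) (h p b)"
    and h_0: "\<theta> 0 b0 = D (Suc 0) (h 0 b0)"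
    and h_Suc: "\<And>p b. b \<in> B (Suc p) \<Longrightarrow>
      \<theta> (Suc p) b = D (Suc (Suc p)) (h (Suc p) b) + lin (h p) (D (Suc p) (bvec b))"
    using null_homotopy[OF th_free th_hom th_chain th_0] by metis
  have \<phi>': "cochain \<Gamma> p \<phi>" "cobd \<Gamma> p \<phi> = (\<lambda>_. 0)"
    using \<phi> by (auto simp: cocycle_def)
  have Dh: "pair \<phi> (D (Suc p) (h p b)) = 0" if "b \<in> B p" "s p b \<in> \<Gamma>" for b
    using pair_D[OF \<Gamma>(1) \<phi>'(1) h_free[OF that(1)] h_hom[OF that(1)]] \<Gamma>(2) that(2)
    by (simp add: \<phi>'(2) pair_eq_zero)
  show ?thesis
  proof (cases p)
    case 0
    then show ?thesis
      using Dh[of b0] h_0 by (auto simp: B_0 fun_eq_iff)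
  next
    case (Suc q)
    define \<psi> where "\<psi> b = (if b \<in> B q \<and> s q b \<in> \<Gamma> then pair \<phi> (h q b) else 0)" for b
    have "pair \<phi> (\<theta> p b) = pair \<psi> (D (Suc q) (bvec b))" if b: "b \<in> B p" "s p b \<in> \<Gamma>" for b
    proof -
      have "pair \<phi> (\<theta> p b) = pair (\<lambda>b'. pair \<phi> (h q b')) (D (Suc q) (bvec b))"
        using Dh[OF b] b h_Suc[of b q] by (simp add: Suc pair_add pair_lin)
      also have "\<dots> = pair \<psi> (D (Suc q) (bvec b))"
      proof (rule pair_cong)
        fix b' assume b': "b' \<in> supp (D (Suc q) (bvec b))"
        then have b'B: "b' \<in> B q"
          using b Suc by (intro free_modD[OF D_free[OF bvec_free_mod] b']) simp
        obtain m where "m \<in> supp (lk (D (Suc q) (bvec b)) b')"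
          using keys_lookup_nonempty[OF b'] by blast
        then have m: "s q b' + deg m = s p b"
          using D_bvec_homogeneous[of b q] b b' Suc by (auto simp: homogeneous_vec_def)
        have "pair \<phi> (h q b') = 0" if "s q b' \<notin> \<Gamma>"
        proof (rule pair_outside[OF \<Gamma>(1) \<phi>'(1)])
          show "homogeneous_vec deg (s p) (s q b' + e) (h q b')"
            using h_hom[OF b'B] Suc by simp
          have "(s q b' + e) + deg m = s p b + e"
            using m by (metis add.assoc add.commute)
          then show "(s q b' + e) + deg m \<in> \<Gamma>"
            using \<Gamma>(2) b by metis
          show "s q b' + e \<notin> \<Gamma>"
            using \<Gamma>(2) that by blast
        qed
        then show "pair \<phi> (h q b') = \<psi> b'"
          using b'B by (simp add: \<psi>_def)
      qed
      finally show ?thesis .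
    qed
    then have "cobd \<Gamma> q \<psi> = (\<lambda>b. if b \<in> B p \<and> s p b \<in> \<Gamma> then pair \<phi> (\<theta> p b) else 0)"
      by (auto simp: cobd_def Suc)
    moreover have "cochain \<Gamma> q \<psi>"
      by (simp add: cochain_def \<psi>_def)
    ultimately show ?thesis
      by (auto simp: Suc)
  qed
qed

text \<open>Multiplication by \<open>f \<in> I\<close> is zero on \<open>S/I\<close>, hence null-homotopic on the resolution, while on
  cochains it is multiplication by the nonzero scalar \<open>ev f\<close>.\<close>

lemma acyclic_invariant:
  assumes \<Gamma>: "convex_degs \<Gamma>" "\<And>c. c \<in> \<Gamma> \<longleftrightarrow> c + e \<in> \<Gamma>"
    and f: "f \<in> I" "homogeneous deg e f" "ev f \<noteq> 0"
  shows "acyclic_at \<Gamma> p"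
  unfolding acyclic_at_def
proof (intro allI impI)
  fix \<phi> assume \<phi>: "cocycle \<Gamma> p \<phi>"
  have "coboundary \<Gamma> p (\<lambda>b. if b \<in> B p \<and> s p b \<in> \<Gamma> then pair \<phi> (smul f (bvec b)) else 0)"
  proof (rule null_homotopic_coboundary[OF \<Gamma> \<phi>])
    show "homogeneous_vec deg (s p) (s p b + e) (smul f (bvec b))" for p b
      by (intro homogeneous_vec_smul f homogeneous_vec_bvec)
    show "D (Suc p) (smul f (bvec b)) = lin (\<lambda>b. smul f (bvec b)) (D (Suc p) (bvec b))" for p b
      by (simp add: D_smul lin_scaled lin_bvecs)
    show "smul f (bvec b0) \<in> bdry 0"
      using f(1) by (simp add: bdry_0 smul_single)
  qed (auto intro: free_mod_smul bvec_free_mod)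
  also have "(\<lambda>b. if b \<in> B p \<and> s p b \<in> \<Gamma> then pair \<phi> (smul f (bvec b)) else 0) = (\<lambda>b. ev f * \<phi> b)"
    using \<phi> by (intro ext) (auto simp: cocycle_def pair_smul cochain_def)
  finally have "coboundary \<Gamma> p (\<lambda>b. inverse (ev f) * (ev f * \<phi> b))"
    by (rule coboundary_scale)
  then show "coboundary \<Gamma> p \<phi>"
    using f(3) by (simp add: mult.assoc[symmetric])
qed

text \<open>Compare with a second resolution \<open>G\<close> that is graded by a coarser degree \<open>tdeg\<close>. The composite
  \<open>F \<rightarrow> G \<rightarrow> F\<close> is homotopic to the identity. A cochain on \<open>\<Gamma>\<close> vanishes on it, because it
  factors through basis elements of \<open>G\<^sub>p\<close>, whose degrees do not occur in \<open>\<Gamma>\<close>. The composite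
  respects only the coarser degree, so it is replaced by its part \<open>\<tau>\<close> of multidegree 0.\<close>

lemma acyclic_compare:
  fixes tdeg :: "'g \<Rightarrow> 't::cancel_comm_monoid_add"
  assumes \<Gamma>: "convex_degs \<Gamma>"
    and tdeg: "\<And>u v. tdeg (u + v) = tdeg u + tdeg v"
    and G: "graded_resolution (\<lambda>m. tdeg (deg m)) B' s' D' I b0'"
    and none: "\<And>c g. c \<in> \<Gamma> \<Longrightarrow> g \<in> B' p \<Longrightarrow> tdeg c \<noteq> s' p g"
  shows "acyclic_at \<Gamma> p"
  unfolding acyclic_at_def
proof (intro allI impI)
  fix \<phi> assume \<phi>: "cocycle \<Gamma> p \<phi>"
  have tdeg_zero: "tdeg 0 = 0"
    using tdeg[of 0 0] by simp
  have F: "graded_resolution (\<lambda>m. tdeg (deg m)) B (\<lambda>p b. tdeg (s p b)) D I b0"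
  proof (intro graded_resolution.intro grading.intro graded_resolution_axioms.intro)
    fix b p assume "b \<in> B (Suc p)"
    then show "homogeneous_vec (\<lambda>m. tdeg (deg m)) (\<lambda>b. tdeg (s p b)) (tdeg (s (Suc p) b))
        (D (Suc p) (bvec b))"
      using D_bvec_homogeneous[of b p] by (simp add: homogeneous_vec_def tdeg[symmetric])
  qed (simp_all add: deg_add tdeg D_hom D_free exact B_0 s_0 tdeg_zero image_D1)
  obtain \<alpha> where \<alpha>: "\<alpha> 0 b0 = bvec b0'"
      "\<And>p b. b \<in> B p \<Longrightarrow> \<alpha> p b \<in> free_mod (B' p)"
      "\<And>p b. b \<in> B (Suc p) \<Longrightarrow> D' (Suc p) (\<alpha> (Suc p) b) = lin (\<alpha> p) (D (Suc p) (bvec b))"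
    using comparison_map[OF F G] by metis
  obtain \<beta> where \<beta>: "\<beta> 0 b0' = bvec b0"
      "\<And>p b. b \<in> B' p \<Longrightarrow> \<beta> p b \<in> free_mod (B p)"
      "\<And>p b. b \<in> B' p \<Longrightarrow>
        homogeneous_vec (\<lambda>m. tdeg (deg m)) (\<lambda>b. tdeg (s p b)) (s' p b) (\<beta> p b)"
      "\<And>p b. b \<in> B' (Suc p) \<Longrightarrow> D (Suc p) (\<beta> (Suc p) b) = lin (\<beta> p) (D' (Suc p) (bvec b))"
    using comparison_map[OF G F] by metis
  interpret G: graded_resolution "\<lambda>m. tdeg (deg m)" B' s' D' I b0' by fact
  define \<tau> where "\<tau> p b = hpart deg (s p) (s p b) (lin (\<beta> p) (\<alpha> p b))" for p b
  have ta_free: "\<tau> p b \<in> free_mod (B p)" if "b \<in> B p" for p b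
    unfolding \<tau>_def using that by (intro hpart_free_mod free_mod_lin[OF \<alpha>(2)] \<beta>(2))
  have be_D: "D (Suc p) (lin (\<beta> (Suc p)) v) = lin (\<beta> p) (D' (Suc p) v)"
    if "v \<in> free_mod (B' (Suc p))" for p v
  proof -
    have "D (Suc p) (lin (\<beta> (Suc p)) v) = lin (\<lambda>b. lin (\<beta> p) (D' (Suc p) (bvec b))) v"
      unfolding D_lin_comp by (rule lin_cong) (simp add: \<beta>(4) free_modD[OF that])
    also have "\<dots> = lin (\<beta> p) (D' (Suc p) v)"
      by (simp add: lin_lin[symmetric] G.D_lin[symmetric])
    finally show ?thesis .
  qed
  have ta_chain: "D (Suc p) (\<tau> (Suc p) b) = lin (\<tau> p) (D (Suc p) (bvec b))"
    if b: "b \<in> B (Suc p)" for p b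
  proof -
    have "D (Suc p) (\<tau> (Suc p) b)
        = hpart deg (s p) (s (Suc p) b) (D (Suc p) (lin (\<beta> (Suc p)) (\<alpha> (Suc p) b)))"
      unfolding \<tau>_def using b by (intro D_hpart free_mod_lin[OF \<alpha>(2)] \<beta>(2))
    also have "\<dots> = hpart deg (s p) (s (Suc p) b) (lin (\<lambda>b. lin (\<beta> p) (\<alpha> p b)) (D (Suc p) (bvec b)))"
      using b by (simp add: be_D \<alpha> lin_lin)
    also have "\<dots> = lin (\<tau> p) (D (Suc p) (bvec b))"
      unfolding \<tau>_def by (rule hpart_lin[OF D_bvec_homogeneous[OF b]])
    finally show ?thesis .
  qed
  have ta_0: "\<tau> 0 b0 = bvec b0"
    by (simp add: \<tau>_def \<alpha> \<beta> lin_bvec hpart_homogeneous homogeneous_vec_bvec)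
  have "coboundary \<Gamma> p (\<lambda>b. if b \<in> B p \<and> s p b \<in> \<Gamma> then pair \<phi> (bvec b - \<tau> p b) else 0)"
  proof (rule null_homotopic_coboundary[OF \<Gamma> _ \<phi>, of 0])
    show "homogeneous_vec deg (s p) (s p b + 0) (bvec b - \<tau> p b)" for p b
      unfolding \<tau>_def add_0_right
      by (intro homogeneous_vec_diff homogeneous_vec_bvec homogeneous_hpart)
    show "D (Suc p) (bvec b - \<tau> (Suc p) b) = lin (\<lambda>b. bvec b - \<tau> p b) (D (Suc p) (bvec b))"
      if "b \<in> B (Suc p)" for p b
      by (simp add: D_diff ta_chain[OF that] lin_fun_diff lin_bvecs)
    show "bvec b0 - \<tau> 0 b0 \<in> bdry 0"
      by (simp add: ta_0 zero_bdry)
  qed (auto intro: free_mod_diff ta_free bvec_free_mod)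
  moreover have "pair \<phi> (\<tau> p b) = 0" if b: "b \<in> B p" "s p b \<in> \<Gamma>" for b
  proof (rule pair_eq_zero)
    fix b' assume b': "b' \<in> supp (\<tau> p b)"
    obtain m where m: "m \<in> supp (lk (\<tau> p b) b')"
      using keys_lookup_nonempty[OF b'] by blast
    then have sm: "s p b' + deg m = s p b" and "m \<in> supp (lk (lin (\<beta> p) (\<alpha> p b)) b')"
      by (auto simp: \<tau>_def in_keys_iff lookup_hpart split: if_splits)
    then obtain g m1 m2 where g: "g \<in> supp (\<alpha> p b)" "m2 \<in> supp (lk (\<beta> p g) b')" "m = m1 + m2"
      using lookup_keys_lin_elim[of m "\<beta> p" "\<alpha> p b" b'] by metis
    have gB: "g \<in> B' p"
      using free_modD[OF \<alpha>(2)[OF b(1)]] g(1) .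
    have "b' \<in> supp (\<beta> p g)"
      using g(2) by (auto simp: in_keys_iff)
    then have "tdeg (s p b' + deg m2) = s' p g"
      using \<beta>(3)[OF gB] g(2) by (simp add: homogeneous_vec_def tdeg)
    \<comment> \<open>The degree \<open>s p b' + deg m2\<close> lies between those of \<open>b'\<close> and \<open>b\<close>, so convexity applies.\<close>
    then have "s p b' + deg m2 \<notin> \<Gamma>"
      using none gB by blast
    moreover have "s p b' + deg m2 + deg m1 \<in> \<Gamma>"
      using sm b(2) by (simp add: g(3) deg_add add_ac)
    ultimately have "s p b' \<notin> \<Gamma>"
      using \<Gamma> unfolding convex_degs_def by blast
    then show "\<phi> b' = 0"
      using \<phi> by (auto simp: cocycle_def cochain_def)
  qed
  ultimately have "coboundary \<Gamma> p (\<lambda>b. if b \<in> B p \<and> s p b \<in> \<Gamma> then \<phi> b else 0)"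
    by (simp add: pair_diff cong: if_cong)
  also have "(\<lambda>b. if b \<in> B p \<and> s p b \<in> \<Gamma> then \<phi> b else 0) = \<phi>"
    using \<phi> by (intro ext) (auto simp: cocycle_def cochain_def)
  finally show "coboundary \<Gamma> p \<phi>" .
qed

end

section \<open>Long exact sequences\<close>

context evaluated_resolution
begin

text \<open>The short exact sequence \<open>0 \<rightarrow> N\<^sub>\<Gamma>\<^sub>' \<rightarrow> N\<^sub>\<Gamma> \<rightarrow> N\<^sub>\<Gamma>\<^sub>'\<^sub>' \<rightarrow> 0\<close>: the upper part \<open>\<Gamma>'\<close> is the submodule and
  the lower part \<open>\<Gamma>''\<close> is the quotient. Convexity of the two parts follows.\<close>

definition splits :: "'g set \<Rightarrow> 'g set \<Rightarrow> 'g set \<Rightarrow> bool" where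
  "splits \<Gamma> \<Gamma>' \<Gamma>'' \<longleftrightarrow> convex_degs \<Gamma> \<and> \<Gamma> = \<Gamma>' \<union> \<Gamma>'' \<and> \<Gamma>' \<inter> \<Gamma>'' = {}
     \<and> (\<forall>u v. u \<in> \<Gamma>' \<longrightarrow> u + v \<in> \<Gamma> \<longrightarrow> u + v \<in> \<Gamma>')"

definition restr :: "nat \<Rightarrow> 'g set \<Rightarrow> ('b \<Rightarrow> 'q) \<Rightarrow> ('b \<Rightarrow> 'q)" where
  "restr p \<Gamma> \<phi> = (\<lambda>b. if s p b \<in> \<Gamma> then \<phi> b else 0)"

lemma cochain_mono: "cochain \<Gamma>' p \<phi> \<Longrightarrow> \<Gamma>' \<subseteq> \<Gamma> \<Longrightarrow> cochain \<Gamma> p \<phi>"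
  by (auto simp: cochain_def)

lemma cochain_restr: "cochain \<Gamma> p \<phi> \<Longrightarrow> cochain \<Gamma>'' p (restr p \<Gamma>'' \<phi>)"
  by (auto simp: cochain_def restr_def)

lemma restr_id: "cochain \<Gamma>'' p \<phi> \<Longrightarrow> restr p \<Gamma>'' \<phi> = \<phi>"
  by (intro ext) (auto simp: cochain_def restr_def)

lemma restr_zero [simp]: "restr p \<Gamma> (\<lambda>_. 0) = (\<lambda>_. 0)"
  by (auto simp: restr_def)

lemma restr_disjoint: "cochain \<Gamma>' p \<phi> \<Longrightarrow> \<Gamma>' \<inter> \<Gamma>'' = {} \<Longrightarrow> restr p \<Gamma>'' \<phi> = (\<lambda>_. 0)"
  by (intro ext) (auto simp: cochain_def restr_def)

lemma restr_diff: "restr p \<Gamma> (\<lambda>b. \<phi> b - \<psi> b) = (\<lambda>b. restr p \<Gamma> \<phi> b - restr p \<Gamma> \<psi> b)"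
  by (auto simp: restr_def)

lemma cochain_from_restr:
  assumes "splits \<Gamma> \<Gamma>' \<Gamma>''" "cochain \<Gamma> p \<phi>" "restr p \<Gamma>'' \<phi> = (\<lambda>_. 0)"
  shows "cochain \<Gamma>' p \<phi>"
  unfolding cochain_def
proof (intro allI impI)
  fix b assume "\<phi> b \<noteq> 0"
  moreover have "s p b \<notin> \<Gamma>''"
    using fun_cong[OF assms(3), of b] \<open>\<phi> b \<noteq> 0\<close> by (auto simp: restr_def)
  ultimately show "b \<in> B p \<and> s p b \<in> \<Gamma>'"
    using assms(1,2) by (auto simp: cochain_def splits_def)
qed

lemma keys_D_bvec:
  assumes "b \<in> B (Suc p)" "b' \<in> supp (D (Suc p) (bvec b))"
  obtains u where "s (Suc p) b = s p b' + u"
proof -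
  obtain m where "m \<in> supp (lk (D (Suc p) (bvec b)) b')"
    using keys_lookup_nonempty[OF assms(2)] by blast
  then show ?thesis
    using D_bvec_homogeneous[OF assms(1)] assms(2) that[of "deg m"]
    by (auto simp: homogeneous_vec_def)
qed

lemma cobd_sub:
  assumes "splits \<Gamma> \<Gamma>' \<Gamma>''" "cochain \<Gamma>' p \<phi>"
  shows "cobd \<Gamma> p \<phi> = cobd \<Gamma>' p \<phi>"
proof
  fix b
  have "pair \<phi> (D (Suc p) (bvec b)) = 0"
    if b: "b \<in> B (Suc p)" "s (Suc p) b \<in> \<Gamma>" "s (Suc p) b \<notin> \<Gamma>'"
  proof (rule pair_eq_zero)
    fix b' assume "b' \<in> supp (D (Suc p) (bvec b))"
    then obtain u where "s (Suc p) b = s p b' + u"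
      using keys_D_bvec[OF b(1)] by blast
    then have "s p b' \<notin> \<Gamma>'"
      using b assms(1) by (auto simp: splits_def)
    then show "\<phi> b' = 0"
      using assms(2) by (auto simp: cochain_def)
  qed
  then show "cobd \<Gamma> p \<phi> b = cobd \<Gamma>' p \<phi> b"
    using assms(1) by (auto simp: cobd_def splits_def)
qed

lemma cobd_restr:
  assumes "splits \<Gamma> \<Gamma>' \<Gamma>''" "cochain \<Gamma> p \<phi>"
  shows "cobd \<Gamma>'' p (restr p \<Gamma>'' \<phi>) = restr (Suc p) \<Gamma>'' (cobd \<Gamma> p \<phi>)"
proof
  fix b
  have "pair (restr p \<Gamma>'' \<phi>) (D (Suc p) (bvec b)) = pair \<phi> (D (Suc p) (bvec b))"
    if b: "b \<in> B (Suc p)" "s (Suc p) b \<in> \<Gamma>''"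
  proof (rule pair_cong)
    fix b' assume "b' \<in> supp (D (Suc p) (bvec b))"
    then obtain u where "s (Suc p) b = s p b' + u"
      using keys_D_bvec[OF b(1)] by blast
    then have "s p b' \<notin> \<Gamma>'"
      using b assms(1) unfolding splits_def by (metis UnI2 disjoint_iff)
    then show "restr p \<Gamma>'' \<phi> b' = \<phi> b'"
      using assms by (auto simp: cochain_def restr_def splits_def)
  qed
  then show "cobd \<Gamma>'' p (restr p \<Gamma>'' \<phi>) b = restr (Suc p) \<Gamma>'' (cobd \<Gamma> p \<phi>) b"
    using assms(1) by (auto simp: cobd_def splits_def restr_def)
qed

lemma coboundary_restr:
  assumes "splits \<Gamma> \<Gamma>' \<Gamma>''" "coboundary \<Gamma> p \<phi>"
  shows "coboundary \<Gamma>'' p (restr p \<Gamma>'' \<phi>)"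
proof (cases p)
  case 0
  then show ?thesis using assms by simp
next
  case (Suc q)
  then obtain \<psi> where "cochain \<Gamma> q \<psi>" "cobd \<Gamma> q \<psi> = \<phi>"
    using assms by auto
  then show ?thesis
    using assms(1) Suc
    by (auto intro!: exI[of _ "restr q \<Gamma>'' \<psi>"] simp: cobd_restr cochain_restr)
qed

text \<open>The connecting homomorphism \<open>H\<^sup>p(\<Gamma>'') \<rightarrow> H\<^sup>p\<^sup>+\<^sup>1(\<Gamma>')\<close>: extend by zero and differentiate.\<close>

lemma cocycle_connecting:
  assumes "splits \<Gamma> \<Gamma>' \<Gamma>''" "cocycle \<Gamma>'' p \<phi>"
  shows "cocycle \<Gamma>' (Suc p) (cobd \<Gamma> p \<phi>)"
proof -
  have \<phi>: "cochain \<Gamma> p \<phi>"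
    using assms by (auto simp: cocycle_def splits_def intro: cochain_mono)
  have "restr (Suc p) \<Gamma>'' (cobd \<Gamma> p \<phi>) = cobd \<Gamma>'' p (restr p \<Gamma>'' \<phi>)"
    using cobd_restr[OF assms(1) \<phi>] by simp
  also have "\<dots> = (\<lambda>_. 0)"
    using assms(2) by (simp add: restr_id cocycle_def)
  finally have c: "cochain \<Gamma>' (Suc p) (cobd \<Gamma> p \<phi>)"
    by (rule cochain_from_restr[OF assms(1) cochain_cobd])
  have "cobd \<Gamma>' (Suc p) (cobd \<Gamma> p \<phi>) = cobd \<Gamma> (Suc p) (cobd \<Gamma> p \<phi>)"
    using cobd_sub[OF assms(1) c] by simp
  also have "\<dots> = (\<lambda>_. 0)"
    using assms(1) \<phi> by (intro cobd_cobd) (auto simp: splits_def)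
  finally show ?thesis
    using c by (simp add: cocycle_def)
qed

text \<open>Exactness of \<open>H\<^sup>p(\<Gamma>) \<rightarrow> H\<^sup>p(\<Gamma>'') \<rightarrow> H\<^sup>p\<^sup>+\<^sup>1(\<Gamma>')\<close> in the middle.\<close>

lemma acyclic_quotient:
  assumes sp: "splits \<Gamma> \<Gamma>' \<Gamma>''" and "acyclic_at \<Gamma> p" "acyclic_at \<Gamma>' (Suc p)"
  shows "acyclic_at \<Gamma>'' p"
  unfolding acyclic_at_def
proof (intro allI impI)
  fix \<phi> assume \<phi>: "cocycle \<Gamma>'' p \<phi>"
  then have \<phi>c: "cochain \<Gamma> p \<phi>"
    using sp by (auto simp: cocycle_def splits_def intro: cochain_mono)
  obtain \<omega> where \<omega>: "cochain \<Gamma>' p \<omega>" "cobd \<Gamma>' p \<omega> = cobd \<Gamma> p \<phi>"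
    using assms(3) cocycle_connecting[OF sp \<phi>] by (auto simp: acyclic_at_def)
  have "cochain \<Gamma> p \<omega>"
    using \<omega>(1) sp by (auto simp: splits_def intro: cochain_mono)
  then have "cocycle \<Gamma> p (\<lambda>b. \<phi> b - \<omega> b)"
    using \<phi>c \<omega> cobd_sub[OF sp \<omega>(1)] by (simp add: cocycle_def cochain_diff cobd_diff)
  then have "coboundary \<Gamma>'' p (restr p \<Gamma>'' (\<lambda>b. \<phi> b - \<omega> b))"
    using assms(2) by (intro coboundary_restr[OF sp]) (auto simp: acyclic_at_def)
  also have "restr p \<Gamma>'' (\<lambda>b. \<phi> b - \<omega> b) = \<phi>"
    using \<phi> sp by (simp add: restr_diff restr_id cocycle_def restr_disjoint[OF \<omega>(1)] splits_def)
  finally show "coboundary \<Gamma>'' p \<phi>" .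
qed

lemma cocycle_sub:
  assumes "splits \<Gamma> \<Gamma>' \<Gamma>''" "cochain \<Gamma>' p \<phi>"
  shows "cocycle \<Gamma>' p \<phi> \<longleftrightarrow> cocycle \<Gamma> p \<phi>"
  using assms cobd_sub[OF assms] by (auto simp: cocycle_def splits_def intro: cochain_mono)

lemma cocycle_restr:
  assumes "splits \<Gamma> \<Gamma>' \<Gamma>''" "cocycle \<Gamma> p \<phi>"
  shows "cocycle \<Gamma>'' p (restr p \<Gamma>'' \<phi>)"
  using assms by (auto simp: cocycle_def cobd_restr cochain_restr)

text \<open>Injectivity of \<open>H\<^sup>0(\<Gamma>') \<rightarrow> H\<^sup>0(\<Gamma>)\<close>.\<close>

lemma acyclic_sub_0:
  assumes sp: "splits \<Gamma> \<Gamma>' \<Gamma>''" and "acyclic_at \<Gamma> 0"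
  shows "acyclic_at \<Gamma>' 0"
  using assms cocycle_sub[OF sp] by (auto simp: acyclic_at_def cocycle_def)

text \<open>Exactness of \<open>H\<^sup>p(\<Gamma>'') \<rightarrow> H\<^sup>p\<^sup>+\<^sup>1(\<Gamma>') \<rightarrow> H\<^sup>p\<^sup>+\<^sup>1(\<Gamma>)\<close> in the middle.\<close>

lemma acyclic_sub_Suc:
  assumes sp: "splits \<Gamma> \<Gamma>' \<Gamma>''" and "acyclic_at \<Gamma>'' p" "acyclic_at \<Gamma> (Suc p)"
  shows "acyclic_at \<Gamma>' (Suc p)"
  unfolding acyclic_at_def
proof (intro allI impI)
  fix \<phi> assume \<phi>: "cocycle \<Gamma>' (Suc p) \<phi>"
  then have \<phi>c: "cochain \<Gamma>' (Suc p) \<phi>"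
    by (simp add: cocycle_def)
  have convex: "convex_degs \<Gamma>"
    using sp unfolding splits_def by (rule conjunct1)
  obtain \<omega> where \<omega>: "cochain \<Gamma> p \<omega>" "cobd \<Gamma> p \<omega> = \<phi>"
    using assms(3) \<phi> cocycle_sub[OF sp \<phi>c] by (auto simp: acyclic_at_def)
  have "cobd \<Gamma>'' p (restr p \<Gamma>'' \<omega>) = (\<lambda>_. 0)"
    using restr_disjoint[OF \<phi>c, of \<Gamma>''] sp \<omega> by (simp add: cobd_restr splits_def)
  then have "coboundary \<Gamma>'' p (restr p \<Gamma>'' \<omega>)"
    using assms(2) \<omega>(1) by (auto simp: acyclic_at_def cocycle_def cochain_restr)
  then show "coboundary \<Gamma>' (Suc p) \<phi>"
  proof (cases p)
    case 0
    then have "cochain \<Gamma>' p \<omega>"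
      using \<open>coboundary \<Gamma>'' p (restr p \<Gamma>'' \<omega>)\<close> \<omega>(1) by (intro cochain_from_restr[OF sp]) auto
    then show ?thesis
      using cobd_sub[OF sp] \<omega>(2) by auto
  next
    case (Suc q)
    then obtain \<psi> where \<psi>: "cochain \<Gamma>'' q \<psi>" "cobd \<Gamma>'' q \<psi> = restr p \<Gamma>'' \<omega>"
      using \<open>coboundary \<Gamma>'' p (restr p \<Gamma>'' \<omega>)\<close> by auto
    have \<psi>c: "cochain \<Gamma> q \<psi>"
      using \<psi>(1) sp by (auto simp: splits_def intro: cochain_mono)
    let ?\<omega> = "\<lambda>b. \<omega> b - cobd \<Gamma> q \<psi> b"
    have "restr p \<Gamma>'' ?\<omega> = (\<lambda>_. 0)"
      using cobd_restr[OF sp \<psi>c] \<psi> Suc by (simp add: restr_diff restr_id)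
    then have c: "cochain \<Gamma>' p ?\<omega>"
      using cochain_diff[OF \<omega>(1)] cochain_cobd[of \<Gamma> q \<psi>] Suc
      by (intro cochain_from_restr[OF sp]) auto
    have "cobd \<Gamma> p ?\<omega> = \<phi>"
      using cobd_cobd[OF convex \<psi>c] \<omega>(2) Suc by (simp add: cobd_diff)
    then show ?thesis
      using c cobd_sub[OF sp c] by auto
  qed
qed

text \<open>The dimension of \<open>H\<^sup>p(\<Gamma>)\<close> over \<open>Q\<close> is at least \<open>n\<close>. Naming \<open>n\<close> independent classes avoids
  quotient spaces and questions of finiteness.\<close>

definition many_classes :: "'g set \<Rightarrow> nat \<Rightarrow> nat \<Rightarrow> bool" where
  "many_classes \<Gamma> p n \<longleftrightarrow> (\<exists>\<phi> :: nat \<Rightarrow> 'b \<Rightarrow> 'q. (\<forall>i<n. cocycle \<Gamma> p (\<phi> i)) \<and>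
     (\<forall>c. coboundary \<Gamma> p (\<lambda>b. \<Sum>i<n. c i * \<phi> i b) \<longrightarrow> (\<forall>i<n. c i = 0)))"

lemma many_classes_0 [simp]: "many_classes \<Gamma> p 0"
  by (simp add: many_classes_def)

lemma cocycle_sum:
  "(\<And>i. i < n \<Longrightarrow> cocycle \<Gamma> p (\<phi> i)) \<Longrightarrow> cocycle \<Gamma> p (\<lambda>b. \<Sum>i<(n::nat). c i * \<phi> i b)"
  by (auto simp: cocycle_def cobd_sum cobd_scale intro!: cochain_sum cochain_scale)

lemma sum_lessThan_add: "(\<Sum>i<m + n. f i) = (\<Sum>i<m. f i) + (\<Sum>i<n. f (m + i))"
  for f :: "nat \<Rightarrow> 'z::comm_monoid_add"
  by (induction n) (auto simp: add.assoc)

text \<open>The exact sequence \<open>0 \<rightarrow> H\<^sup>p(\<Gamma>'') \<rightarrow> H\<^sup>p\<^sup>+\<^sup>1(\<Gamma>') \<rightarrow> H\<^sup>p\<^sup>+\<^sup>1(\<Gamma>) \<rightarrow> 0\<close>. Classes of \<open>\<Gamma>''\<close> go to \<open>\<Gamma>'\<close> by the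
  connecting homomorphism, and classes \<open>\<chi>\<close> of \<open>\<Gamma>\<close> are moved into \<open>\<Gamma>'\<close> by a coboundary that
  kills their restriction to \<open>\<Gamma>''\<close>.\<close>

lemma many_classes_add:
  assumes sp: "splits \<Gamma> \<Gamma>' \<Gamma>''" and "acyclic_at \<Gamma> p" "acyclic_at \<Gamma>'' (Suc p)"
    and "many_classes \<Gamma>'' p m" "many_classes \<Gamma> (Suc p) n"
  shows "many_classes \<Gamma>' (Suc p) (m + n)"
proof -
  have convex: "convex_degs \<Gamma>"
    using sp unfolding splits_def by (rule conjunct1)
  obtain \<phi> where \<phi>: "\<And>i. i < m \<Longrightarrow> cocycle \<Gamma>'' p (\<phi> i)"
    and \<phi>_ind: "\<And>c i. coboundary \<Gamma>'' p (\<lambda>b. \<Sum>i<m. c i * \<phi> i b) \<Longrightarrow> i < m \<Longrightarrow> c i = 0"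
    using assms(4) unfolding many_classes_def by metis
  obtain \<chi> where \<chi>: "\<And>i. i < n \<Longrightarrow> cocycle \<Gamma> (Suc p) (\<chi> i)"
    and \<chi>_ind: "\<And>c i. coboundary \<Gamma> (Suc p) (\<lambda>b. \<Sum>i<n. c i * \<chi> i b) \<Longrightarrow> i < n \<Longrightarrow> c i = 0"
    using assms(5) unfolding many_classes_def by metis
  have "\<exists>\<omega>. cochain \<Gamma>'' p \<omega> \<and> cobd \<Gamma>'' p \<omega> = restr (Suc p) \<Gamma>'' (\<chi> i)" if "i < n" for i
    using assms(3) cocycle_restr[OF sp \<chi>[OF that]] by (auto simp: acyclic_at_def)
  then obtain \<omega> where \<omega>: "\<And>i. i < n \<Longrightarrow> cochain \<Gamma>'' p (\<omega> i)"
      "\<And>i. i < n \<Longrightarrow> cobd \<Gamma>'' p (\<omega> i) = restr (Suc p) \<Gamma>'' (\<chi> i)"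
    by metis
  have \<phi>c: "cochain \<Gamma> p (\<phi> i)" if "i < m" for i
    using \<phi>[OF that] sp by (auto simp: cocycle_def splits_def intro: cochain_mono)
  have \<omega>c: "cochain \<Gamma> p (\<omega> i)" if "i < n" for i
    using \<omega>(1)[OF that] sp by (auto simp: splits_def intro: cochain_mono)
  define \<theta> where "\<theta> i = (if i < m then cobd \<Gamma> p (\<phi> i)
      else (\<lambda>b. \<chi> (i - m) b - cobd \<Gamma> p (\<omega> (i - m)) b))" for i
  have th2: "cocycle \<Gamma>' (Suc p) (\<lambda>b. \<chi> i b - cobd \<Gamma> p (\<omega> i) b)" if "i < n" for i
  proof -
    let ?\<theta> = "\<lambda>b. \<chi> i b - cobd \<Gamma> p (\<omega> i) b"
    have 1: "cochain \<Gamma> (Suc p) ?\<theta>"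
      using \<chi>[OF that] cochain_cobd by (intro cochain_diff) (auto simp: cocycle_def)
    have "restr (Suc p) \<Gamma>'' ?\<theta> = (\<lambda>_. 0)"
      using cobd_restr[OF sp \<omega>c[OF that]] \<omega>[OF that] by (simp add: restr_diff restr_id)
    then have 2: "cochain \<Gamma>' (Suc p) ?\<theta>"
      using 1 by (intro cochain_from_restr[OF sp]) auto
    have "cobd \<Gamma> (Suc p) ?\<theta> = (\<lambda>_. 0)"
      using \<chi>[OF that] cobd_cobd[OF convex \<omega>c[OF that]]
      by (simp add: cobd_diff cocycle_def)
    then show ?thesis
      using 1 cocycle_sub[OF sp 2] by (simp add: cocycle_def)
  qed
  have cyc: "cocycle \<Gamma>' (Suc p) (\<theta> i)" if "i < m + n" for i
    using that cocycle_connecting[OF sp \<phi>] th2 by (auto simp: \<theta>_def)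
  have "c i = 0" if cob: "coboundary \<Gamma>' (Suc p) (\<lambda>b. \<Sum>i<m + n. c i * \<theta> i b)" and i: "i < m + n"
    for c i
  proof -
    obtain \<psi> where \<psi>': "cochain \<Gamma>' p \<psi>" "cobd \<Gamma>' p \<psi> = (\<lambda>b. \<Sum>i<m + n. c i * \<theta> i b)"
      using cob by auto
    have \<psi>: "cochain \<Gamma> p \<psi>"
      using \<psi>'(1) sp by (auto simp: splits_def intro: cochain_mono)
    let ?\<phi> = "\<lambda>b. \<Sum>i<m. c i * \<phi> i b"
    let ?\<omega> = "\<lambda>b. \<Sum>i<n. c (m + i) * \<omega> i b"
    let ?\<chi> = "\<lambda>b. \<Sum>i<n. c (m + i) * \<chi> i b"
    have \<phi>\<omega>: "cochain \<Gamma> p ?\<phi>" "cochain \<Gamma> p ?\<omega>"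
      by (auto intro!: cochain_sum cochain_scale \<phi>c \<omega>c)
    have eq: "cobd \<Gamma> p \<psi> = (\<lambda>b. cobd \<Gamma> p ?\<phi> b + (?\<chi> b - cobd \<Gamma> p ?\<omega> b))"
      unfolding cobd_sub[OF sp \<psi>'(1)] \<psi>'(2) cobd_sum cobd_scale sum_lessThan_add
      by (simp add: \<theta>_def right_diff_distrib sum_subtractf)
    \<comment> \<open>The image of the relation in \<open>H\<^sup>p\<^sup>+\<^sup>1(\<Gamma>)\<close> involves only the classes \<open>\<chi> i\<close>.\<close>
    have "cobd \<Gamma> p (\<lambda>b. \<psi> b - (?\<phi> b - ?\<omega> b)) = ?\<chi>"
      unfolding cobd_diff[of \<Gamma> p \<psi>] cobd_diff[of \<Gamma> p ?\<phi>] eq by simp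
    then have "coboundary \<Gamma> (Suc p) ?\<chi>"
      using \<psi> \<phi>\<omega> by (auto intro!: exI[of _ "\<lambda>b. \<psi> b - (?\<phi> b - ?\<omega> b)"] cochain_diff)
    then have c2: "c (m + i) = 0" if "i < n" for i
      using \<chi>_ind[of "\<lambda>i. c (m + i)"] that by simp
    \<comment> \<open>What remains is a relation between connecting classes, and it lifts to \<open>\<Gamma>''\<close> because
        \<open>H\<^sup>p(\<Gamma>) = 0\<close>.\<close>
    have "cobd \<Gamma> p \<psi> = cobd \<Gamma> p ?\<phi>"
      unfolding eq by (auto simp: c2)
    then have "cocycle \<Gamma> p (\<lambda>b. ?\<phi> b - \<psi> b)"
      using \<psi> \<phi>\<omega>(1) by (simp add: cocycle_def cochain_diff cobd_diff)
    then have "coboundary \<Gamma>'' p (restr p \<Gamma>'' (\<lambda>b. ?\<phi> b - \<psi> b))"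
      using assms(2) by (intro coboundary_restr[OF sp]) (auto simp: acyclic_at_def)
    also have "restr p \<Gamma>'' (\<lambda>b. ?\<phi> b - \<psi> b) = ?\<phi>"
    proof -
      have "cochain \<Gamma>'' p ?\<phi>"
        using \<phi> by (auto intro!: cochain_sum cochain_scale simp: cocycle_def)
      then show ?thesis
        using sp by (simp add: restr_diff restr_id restr_disjoint[OF \<psi>'(1)] splits_def)
    qed
    finally have c1: "c i = 0" if "i < m" for i
      using \<phi>_ind that by blast
    show "c i = 0"
      using c1 c2[of "i - m"] i by (cases "i < m") auto
  qed
  then show ?thesis
    unfolding many_classes_def using cyc by (intro exI[of _ \<theta>]) auto
qed

end

section \<open>Boxes of multidegrees\<close>

definition weight :: "('c::finite \<Rightarrow>\<^sub>0 nat) \<Rightarrow> int" where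
  "weight c = int (\<Sum>i\<in>UNIV. lk c i)"

lemma weight_add: "weight (c + c') = weight c + weight c'"
  by (simp add: weight_def lookup_add sum.distrib)

lemma weight_single: "weight (Poly_Mapping.single i n) = int n"
  by (simp add: weight_def lookup_single when_def)

lemma weight_mono: "(\<And>i. lk c i \<le> lk c' i) \<Longrightarrow> weight c \<le> weight c'"
  unfolding weight_def by (simp add: sum_mono)

definition box :: "('c \<Rightarrow> nat set) \<Rightarrow> ('c \<Rightarrow>\<^sub>0 nat) set" where
  "box P = {c. \<forall>i. lk c i \<in> P i}"

definition face :: "'c set \<Rightarrow> ('c \<Rightarrow>\<^sub>0 nat) \<Rightarrow> ('c \<Rightarrow>\<^sub>0 nat) set" where
  "face E a = box (\<lambda>i. if i \<in> E then {lk a i} else {..lk a i})"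

text \<open>The three consequences of the hypotheses on \<open>I\<close> that the count needs: vanishing by linearity,
  vanishing by pure elements, and the absence of elements of degree at most \<open>d\<close> in \<open>I\<close>.\<close>

locale linear_setting = evaluated_resolution deg B s D I b0 ev
  for deg :: "('x \<Rightarrow>\<^sub>0 nat) \<Rightarrow> ('c::finite \<Rightarrow>\<^sub>0 nat)"
    and B :: "nat \<Rightarrow> 'b set"
    and s :: "nat \<Rightarrow> 'b \<Rightarrow> ('c \<Rightarrow>\<^sub>0 nat)"
    and D :: "nat \<Rightarrow> ('b \<Rightarrow>\<^sub>0 ('x, 'k::field) mpoly) \<Rightarrow> ('b \<Rightarrow>\<^sub>0 ('x, 'k) mpoly)"
    and I :: "('x, 'k) mpoly set"
    and b0 :: 'b
    and ev :: "('x, 'k) mpoly \<Rightarrow> 'q::field" +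
  fixes d :: int
  assumes linear: "\<And>\<Gamma> p. convex_degs \<Gamma> \<Longrightarrow> (\<And>c. c \<in> \<Gamma> \<Longrightarrow> weight c \<noteq> d + int (Suc p)) \<Longrightarrow>
      acyclic_at \<Gamma> (Suc p)"
    and pure: "\<And>\<Gamma> p i. convex_degs \<Gamma> \<Longrightarrow> (\<And>c n. c \<in> \<Gamma> \<longleftrightarrow> c + Poly_Mapping.single i n \<in> \<Gamma>) \<Longrightarrow>
      acyclic_at \<Gamma> p"
    and low: "\<And>b. b \<in> B 1 \<Longrightarrow> weight (s 1 b) \<le> d \<Longrightarrow> D 1 (bvec b) = 0"
begin

lemma convex_box:
  assumes "\<And>i x y z. x \<in> P i \<Longrightarrow> x + y + z \<in> P i \<Longrightarrow> x + y \<in> P i"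
  shows "convex_degs (box P)"
  unfolding convex_degs_def box_def
proof (intro allI impI CollectI)
  fix u v w :: "'c \<Rightarrow>\<^sub>0 nat" and i
  assume "u \<in> {c. \<forall>i. lk c i \<in> P i}" "u + v + w \<in> {c. \<forall>i. lk c i \<in> P i}"
  then show "lk (u + v) i \<in> P i"
    using assms[of "lk u i" i "lk v i" "lk w i"] by (simp add: lookup_add)
qed

lemma splits_box:
  assumes "convex_degs (box P)"
    and "\<And>j. j \<noteq> i \<Longrightarrow> P' j = P j" "\<And>j. j \<noteq> i \<Longrightarrow> P'' j = P j"
    and "P' i \<union> P'' i = P i" "P' i \<inter> P'' i = {}"
    and up: "\<And>x y. x \<in> P' i \<Longrightarrow> x + y \<in> P i \<Longrightarrow> x + y \<in> P' i"
  shows "splits (box P) (box P') (box P'')"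
proof -
  have P': "box P' = {c \<in> box P. lk c i \<in> P' i}"
    using assms(2,4) unfolding box_def by (auto; metis UnI1)
  have P'': "box P'' = {c \<in> box P. lk c i \<in> P'' i}"
    using assms(3,4) unfolding box_def by (auto; metis UnI2)
  have "lk c i \<in> P i" if "c \<in> box P" for c
    using that by (auto simp: box_def)
  moreover have "lk (u + v) i \<in> P' i" if "lk u i \<in> P' i" "u + v \<in> box P" for u v
    using up[OF that(1), of "lk v i"] that(2) by (simp add: box_def lookup_add)
  ultimately show ?thesis
    unfolding splits_def P' P'' using assms(1,4,5) by auto
qed

text \<open>Here \<open>U\<close> is the set of colours whose condition is still \<open>c\<^sub>i \<le> a\<^sub>i\<close>; in the other directions it has
  been flipped to \<open>c\<^sub>i > a\<^sub>i\<close>. Each flip raises the homological degree and the lower bound for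
  \<open>|c|\<close> by one, since dropping the condition altogether gives a set without cohomology. The
  induction starts at \<open>U = {}\<close>, where linearity applies. It requires positive homological degree
  there, which is the last hypothesis.\<close>

lemma acyclic_flip:
  assumes "finite U" "d + int p < weight a + int (card (- U))" "0 < p + card U"
  shows "acyclic_at (box (\<lambda>i. if i \<in> U then {..lk a i} else {lk a i<..})) p"
  using assms
proof (induction U arbitrary: p rule: finite_induct)
  case empty
  then obtain q where q: "p = Suc q"
    by (cases p) auto
  show ?case
    unfolding q
  proof (rule linear)
    show "convex_degs (box (\<lambda>i. if i \<in> {} then {..lk a i} else {lk a i<..}))"
      by (rule convex_box) auto
    fix c assume "c \<in> box (\<lambda>i. if i \<in> {} then {..lk a i} else {lk a i<..})"
    then have "(\<Sum>i\<in>UNIV. lk a i + 1) \<le> (\<Sum>i\<in>UNIV. lk c i)"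
      by (intro sum_mono) (auto simp: box_def Suc_le_eq)
    then have "(\<Sum>i\<in>UNIV. lk a i) + CARD('c) \<le> (\<Sum>i\<in>UNIV. lk c i)"
      unfolding sum.distrib by simp
    then have "int (\<Sum>i\<in>UNIV. lk a i) + int CARD('c) \<le> weight c"
      unfolding weight_def by linarith
    then show "weight c \<noteq> d + int (Suc q)"
      using empty by (simp add: weight_def q)
  qed
next
  case (insert i U)
  let ?P = "\<lambda>j. if j = i then UNIV else if j \<in> U then {..lk a j} else {lk a j<..}"
  have convex: "convex_degs (box ?P)"
    by (rule convex_box) (auto split: if_splits)
  have "- U = insert i (- insert i U)"
    using insert.hyps by auto
  then have card: "card (- U) = Suc (card (- insert i U))"
    by (simp add: card_insert_if)
  show ?case
  proof (rule acyclic_quotient)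
    show "splits (box ?P) (box (\<lambda>i. if i \<in> U then {..lk a i} else {lk a i<..}))
       (box (\<lambda>j. if j \<in> insert i U then {..lk a j} else {lk a j<..}))"
      by (rule splits_box[of _ i]) (use convex insert.hyps in auto)
    show "acyclic_at (box ?P) p"
    proof (rule pure[where i = i])
      show "c \<in> box ?P \<longleftrightarrow> c + Poly_Mapping.single i n \<in> box ?P" for c n
        by (auto simp: box_def lookup_add lookup_single when_def split: if_splits; metis)
    qed (rule convex)
    show "acyclic_at (box (\<lambda>i. if i \<in> U then {..lk a i} else {lk a i<..})) (Suc p)"
      using insert.prems card by (intro insert.IH) auto
  qed
qed

lemma convex_face: "convex_degs (face E a)"
  unfolding face_def by (rule convex_box) (auto split: if_splits)

lemma face_weight: "c \<in> face E a \<Longrightarrow> weight c \<le> weight a"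
  by (intro weight_mono) (auto simp: face_def box_def split: if_splits; metis order_refl)

text \<open>The lower part of \<open>face E (a + e\<^sub>i)\<close> consists of the degrees with \<open>c\<^sub>i \<le> a\<^sub>i\<close>, and is therefore
  \<open>face E a\<close>.\<close>

lemma splits_face:
  assumes "i \<notin> E"
  shows "splits (face E (a + Poly_Mapping.single i 1)) (face (insert i E) (a + Poly_Mapping.single i 1))
    (face E a)"
  unfolding face_def
proof (rule splits_box[of _ i])
  show "convex_degs (box (\<lambda>j. if j \<in> E then {lk (a + Poly_Mapping.single i 1) j}
      else {..lk (a + Poly_Mapping.single i 1) j}))"
    by (rule convex_face[unfolded face_def])
qed (use assms in \<open>auto simp: lookup_add lookup_single when_def\<close>)

lemma remove_unit:
  fixes a :: "'c \<Rightarrow>\<^sub>0 nat"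
  assumes "lk a i \<noteq> 0"
  obtains a' where "a = a' + Poly_Mapping.single i 1"
proof
  show "a = (a - Poly_Mapping.single i 1) + Poly_Mapping.single i 1"
    using assms by (intro poly_mapping_eqI) (auto simp: lookup_add lookup_minus lookup_single when_def)
qed

text \<open>Fixing a coordinate with \<open>a\<^sub>i = 0\<close> is no change. Otherwise \<open>a = a' + e\<^sub>i\<close>, and lowering \<open>a\<close> to \<open>a'\<close>
  lowers both sides of the inequality by one together with \<open>p\<close>.\<close>

lemma acyclic_face:
  assumes "finite E" "d + int p < weight a"
  shows "acyclic_at (face E a) p"
  using assms
proof (induction E arbitrary: a p rule: finite_induct)
  case empty
  have "acyclic_at (box (\<lambda>i. if i \<in> (UNIV::'c set) then {..lk a i} else {lk a i<..})) p"
    using empty by (intro acyclic_flip) (auto simp: card_gt_0_iff)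
  then show ?case
    by (simp add: face_def)
next
  case (insert i E)
  show ?case
  proof (cases "lk a i = 0")
    case True
    then have "(if j \<in> insert i E then {lk a j} else {..lk a j})
        = (if j \<in> E then {lk a j} else {..lk a j})" for j
      by auto
    then have "face (insert i E) a = face E a"
      by (simp add: face_def)
    then show ?thesis
      using insert by simp
  next
    case False
    then obtain a' where a: "a = a' + Poly_Mapping.single i 1"
      by (rule remove_unit)
    note sp = splits_face[OF insert.hyps(2), of a', folded a]
    show ?thesis
    proof (cases p)
      case 0
      then show ?thesis
        using acyclic_sub_0[OF sp] insert by simp
    next
      case (Suc q)
      have "acyclic_at (face E a') q"
        using insert.prems by (intro insert.IH) (simp add: a weight_add weight_single Suc)
      moreover have "acyclic_at (face E a) (Suc q)"
        using insert Suc by simp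
      ultimately show ?thesis
        unfolding Suc by (rule acyclic_sub_Suc[OF sp])
    qed
  qed
qed

text \<open>The generator of \<open>F\<^sub>0\<close> gives a cocycle, since a basis element of \<open>F\<^sub>1\<close> of total degree at most
  \<open>d\<close> maps to zero.\<close>

lemma class_in_degree_zero:
  assumes "weight a = d"
  shows "many_classes (face {} a) 0 1"
proof -
  let ?\<phi> = "\<lambda>b. if b = b0 then 1 else 0 :: 'q"
  have "cobd (face {} a) 0 ?\<phi> b = 0" for b
    using low[of b] face_weight[of "s 1 b" "{}" a] assms by (auto simp: cobd_def)
  then have "cocycle (face {} a) 0 ?\<phi>"
    by (auto simp: cocycle_def cochain_def B_0 s_0 face_def box_def)
  moreover have "c (0::nat) = 0" if "(\<lambda>b. c 0 * ?\<phi> b) = (\<lambda>_. 0)" for c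
    using fun_cong[OF that, of b0] by simp
  ultimately show ?thesis
    unfolding many_classes_def by (intro exI[of _ "\<lambda>_. ?\<phi>"]) auto
qed

text \<open>Pascal's recursion. The first summand comes from \<open>face E a'\<close> with \<open>a = a' + e\<^sub>i\<close>, one homological
  degree lower; the second comes from \<open>face E a\<close>. For a singleton \<open>E\<close> the only
  contribution is the class in \<open>H\<^sup>0(face {} a')\<close>.\<close>

lemma many_classes_face:
  assumes "finite E" "E \<noteq> {}" "E \<subseteq> supp a" "weight a = d + int (Suc p)"
  shows "many_classes (face E a) (Suc p) ((card E - 1) choose p)"
  using assms
proof (induction E arbitrary: a p rule: finite_ne_induct)
  case (singleton i)
  then obtain a' where a: "a = a' + Poly_Mapping.single i 1"
    using remove_unit[of a i] by (auto simp: in_keys_iff)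
  have tot: "weight a' = d + int p"
    using singleton by (simp add: a weight_add weight_single)
  have sp: "splits (face {} a) (face {i} a) (face {} a')"
    using splits_face[of i "{}" a', folded a] by simp
  have "many_classes (face {i} a) (Suc p) ((if p = 0 then 1 else 0) + 0)"
  proof (rule many_classes_add[OF sp])
    show "acyclic_at (face {} a) p"
      using singleton by (intro acyclic_face) auto
    show "acyclic_at (face {} a') (Suc p)"
      using face_weight[of _ "{}" a'] tot by (intro linear convex_face) fastforce
    show "many_classes (face {} a') p (if p = 0 then 1 else 0)"
      using class_in_degree_zero[of a'] tot by simp
  qed simp
  then show ?case
    by (cases p) auto
next
  case (insert i E)
  then obtain a' where a: "a = a' + Poly_Mapping.single i 1"
    using remove_unit[of a i] by (auto simp: in_keys_iff)
  have tot: "weight a' = d + int p"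
    using insert by (simp add: a weight_add weight_single)
  have E: "E \<subseteq> supp a'"
  proof
    fix j assume "j \<in> E"
    then have "lk a j \<noteq> 0" "j \<noteq> i"
      using insert by (auto simp: in_keys_iff)
    then show "j \<in> supp a'"
      by (simp add: a lookup_add lookup_single in_keys_iff)
  qed
  define n where "n = (case p of 0 \<Rightarrow> 0 | Suc q \<Rightarrow> (card E - 1) choose q)"
  have "many_classes (face (insert i E) a) (Suc p) (n + ((card E - 1) choose p))"
  proof (rule many_classes_add[OF splits_face[OF insert.hyps(3), of a', folded a]])
    show "acyclic_at (face E a) p"
      using insert by (intro acyclic_face) auto
    show "acyclic_at (face E a') (Suc p)"
      using face_weight[of _ E a'] tot by (intro linear convex_face) fastforce
    show "many_classes (face E a') p n"
      using insert.IH[OF E] tot by (auto simp: n_def split: nat.split)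
    show "many_classes (face E a) (Suc p) ((card E - 1) choose p)"
      using insert by (intro insert.IH) auto
  qed
  moreover have "n + ((card E - 1) choose p) = (card (insert i E) - 1) choose p"
  proof -
    obtain k where "card E = Suc k"
      using insert.hyps by (metis card_eq_0_iff not0_implies_Suc)
    then show ?thesis
      using insert.hyps by (cases p) (auto simp: n_def)
  qed
  ultimately show ?case by simp
qed

end

section \<open>Counting dimensions\<close>

text \<open>Gaussian elimination of the last equation: \<open>k\<close> is the pivot, \<open>f\<close> enumerates the other unknowns,
  and \<open>c'\<close> is obtained from a solution \<open>c\<close> of the reduced system by solving for the pivot.\<close>

lemma homogeneous_system_solution:
  fixes M :: "nat \<Rightarrow> nat \<Rightarrow> 'q::field"
  assumes "m < n"
  shows "\<exists>c. (\<exists>i<n. c i \<noteq> 0) \<and> (\<forall>t<m. (\<Sum>i<n. c i * M i t) = 0)"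
  using assms
proof (induction m arbitrary: n M)
  case 0
  then show ?case by (intro exI[of _ "\<lambda>_. 1"]) auto
next
  case (Suc m)
  then obtain n' where n: "n = Suc n'"
    by (cases n) auto
  show ?case
  proof (cases "\<forall>i<n. M i m = 0")
    case True
    then show ?thesis
      using Suc.IH[of n M] Suc.prems by (auto simp: less_Suc_eq)
  next
    case False
    then obtain k where k: "k < n" "M k m \<noteq> 0"
      by blast
    define f where "f i = (if i < k then i else Suc i)" for i
    define r where "r i = M (f i) m / M k m" for i
    obtain c where c: "\<exists>i<n'. c i \<noteq> 0" "\<forall>t<m. (\<Sum>i<n'. c i * (M (f i) t - r i * M k t)) = 0"
      using Suc.IH[of n' "\<lambda>i t. M (f i) t - r i * M k t"] Suc.prems n by auto
    have bij: "bij_betw f {..<n'} ({..<n} - {k})"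
      by (rule bij_betw_byWitness[of _ "\<lambda>i. if i < k then i else i - 1"])
        (use k n in \<open>auto simp: f_def\<close>)
    define c' where "c' j = (if j = k then - (\<Sum>i<n'. c i * r i) else c (if j < k then j else j - 1))" for j
    have c'f: "c' (f i) = c i" for i
      by (auto simp: c'_def f_def)
    have sum: "(\<Sum>i<n. c' i * M i t) = (\<Sum>i<n'. c i * (M (f i) t - r i * M k t))" for t
    proof -
      have "(\<Sum>i<n. c' i * M i t) = c' k * M k t + (\<Sum>i\<in>{..<n} - {k}. c' i * M i t)"
        using k by (intro sum.remove) auto
      also have "(\<Sum>i\<in>{..<n} - {k}. c' i * M i t) = (\<Sum>i<n'. c' (f i) * M (f i) t)"
        by (rule sum.reindex_bij_betw[OF bij, symmetric])
      finally show ?thesis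
        by (simp add: c'f) (simp add: c'_def algebra_simps sum_subtractf sum_distrib_left)
    qed
    have "(\<Sum>i<n. c' i * M i m) = 0"
      unfolding sum using k by (simp add: r_def)
    then have "\<forall>t<Suc m. (\<Sum>i<n. c' i * M i t) = 0"
      using c(2) sum by (auto simp: less_Suc_eq)
    moreover obtain i where "i < n'" "c i \<noteq> 0"
      using c(1) by blast
    then have "f i < n" "c' (f i) \<noteq> 0"
      using n by (auto simp: c'f) (auto simp: f_def)
    ultimately show ?thesis by blast
  qed
qed

interpretation kvec: vector_space kscale
  by (rule vector_space_kscale)

lemma kdim_basis:
  assumes "kdim V < enat n"
  obtains m w where "m < n" "\<And>t. t < (m::nat) \<Longrightarrow> w t \<in> V"
    "\<And>v. v \<in> V \<Longrightarrow> \<exists>r. v = (\<Sum>t<m. kscale (r t) (w t))"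
proof -
  obtain A where A: "finite A" "V \<subseteq> kvec.span A" and dim: "kvec.dim V < n"
    using assms by (auto simp: kdim_def split: if_splits)
  obtain W where W: "W \<subseteq> V" "kvec.independent W" "V \<subseteq> kvec.span W" "card W = kvec.dim V"
    using kvec.basis_exists[of V] by blast
  have "finite W"
    using kvec.independent_span_bound[OF A(1) W(2)] W(1) A(2) by blast
  then obtain w where w: "bij_betw w {..<card W} W"
    using ex_bij_betw_nat_finite lessThan_atLeast0 by metis
  show ?thesis
  proof (rule that[of "card W" w])
    show "\<exists>r. v = (\<Sum>t<card W. kscale (r t) (w t))" if v: "v \<in> V" for v
    proof -
      obtain r where "v = (\<Sum>x\<in>W. kscale (r x) x)"
        using v W(3) kvec.span_finite[OF \<open>finite W\<close>] by auto
      also have "\<dots> = (\<Sum>t<card W. kscale (r (w t)) (w t))"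
        by (rule sum.reindex_bij_betw[OF w, symmetric])
      finally show ?thesis
        by (rule exI[of _ "\<lambda>t. r (w t)"])
    qed
  qed (use W dim w in \<open>auto simp: bij_betw_def\<close>)
qed

context evaluated_resolution
begin

lemma coboundary_zero: "coboundary \<Gamma> p (\<lambda>_. 0)"
  by (cases p) (auto intro: exI[of _ "\<lambda>_. 0"])

text \<open>A cocycle \<open>\<phi>\<close> on \<open>{a}\<close> induces the functional \<open>D u \<mapsto> pair \<phi> u\<close> on \<open>(\<Omega>\<^sup>p\<^sup>+\<^sup>1)\<^sub>a\<close>, which determines \<open>\<phi>\<close>
  because \<open>\<phi> b\<close> is its value at \<open>D b\<close>. The functionals take values in \<open>Q\<close>, but they are linear over
  the smaller field \<open>k\<close>. If \<open>m < n\<close> vectors \<open>w t\<close> spanned \<open>(\<Omega>\<^sup>p\<^sup>+\<^sup>1)\<^sub>a\<close> over \<open>k\<close>, some nontrivial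
  \<open>Q\<close>-combination of the \<open>n\<close> functionals would vanish on all of them, hence be zero.\<close>

lemma kdim_syzygy_piece:
  assumes cl: "many_classes {a} (Suc p) n" and convex: "convex_degs {a}"
  shows "enat n \<le> kdim (syzygy_piece deg B s D (Suc p) a)"
proof (rule ccontr)
  let ?V = "syzygy_piece deg B s D (Suc p) a"
  assume "\<not> enat n \<le> kdim ?V"
  then have less: "kdim ?V < enat n"
    by simp
  obtain m w where m: "m < n" and w: "\<And>t. t < m \<Longrightarrow> w t \<in> ?V"
    and span: "\<And>v. v \<in> ?V \<Longrightarrow> \<exists>r. v = (\<Sum>t<m. kscale (r t) (w t))"
    by (rule kdim_basis[OF less]) blast
  have "\<exists>u\<in>free_mod (B (Suc p)). homogeneous_vec deg (s (Suc p)) a u \<and> D (Suc p) u = w t"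
    if "t < m" for t
    using w[OF that] by (intro homogeneous_lift) (auto simp: syzygy_piece_def syzygy_def bdry_def)
  then obtain u where u: "\<And>t. t < m \<Longrightarrow> u t \<in> free_mod (B (Suc p))"
      "\<And>t. t < m \<Longrightarrow> homogeneous_vec deg (s (Suc p)) a (u t)"
      "\<And>t. t < m \<Longrightarrow> D (Suc p) (u t) = w t"
    by metis
  obtain \<phi> where \<phi>: "\<And>i. i < n \<Longrightarrow> cocycle {a} (Suc p) (\<phi> i)"
    and ind: "\<And>c i. coboundary {a} (Suc p) (\<lambda>b. \<Sum>i<n. c i * \<phi> i b) \<Longrightarrow> i < n \<Longrightarrow> c i = 0"
    using cl unfolding many_classes_def by metis
  obtain c where c: "\<exists>i<n. c i \<noteq> 0" "\<forall>t<m. (\<Sum>i<n. c i * pair (\<phi> i) (u t)) = 0"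
    using homogeneous_system_solution[OF m, of "\<lambda>i t. pair (\<phi> i) (u t)"] by blast
  define \<Phi> where "\<Phi> = (\<lambda>b. \<Sum>i<n. c i * \<phi> i b)"
  have cyc: "cocycle {a} (Suc p) \<Phi>"
    unfolding \<Phi>_def by (rule cocycle_sum) (rule \<phi>)
  have \<Phi>u: "pair \<Phi> (u t) = 0" if "t < m" for t
    using c(2) that by (simp add: \<Phi>_def pair_fun_sum pair_fun_scale)
  have "\<Phi> b = 0" for b
  proof (cases "b \<in> B (Suc p) \<and> s (Suc p) b = a")
    case False
    then show ?thesis
      using cyc by (auto simp: cocycle_def cochain_def)
  next
    case True
    then have "D (Suc p) (bvec b) \<in> ?V"
      using D_bvec_homogeneous[of b p]
      by (auto simp: syzygy_piece_def syzygy_def intro: bvec_free_mod)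
    then obtain r where r: "D (Suc p) (bvec b) = (\<Sum>t<m. kscale (r t) (w t))"
      using span by blast
    \<comment> \<open>The vectors \<open>y\<close> and \<open>bvec b\<close> have the same image, so they differ by a boundary, on which
        the cocycle is zero.\<close>
    define y where "y = (\<Sum>t<m. kscale (r t) (u t))"
    have k_smul: "kscale (r t) = smul (Poly_Mapping.single 0 (r t))" for t
      by (simp add: kscale_def fun_eq_iff)
    have y_free: "y \<in> free_mod (B (Suc p))"
      unfolding y_def k_smul by (intro free_mod_sum free_mod_smul u) auto
    have "homogeneous_vec deg (s (Suc p)) a (kscale (r t) (u t))" if "t < m" for t
      using homogeneous_vec_smul[OF homogeneous_single[of 0 "r t"] u(2)[OF that]]
      by (simp add: kscale_def deg_zero)
    then have y_hom: "homogeneous_vec deg (s (Suc p)) a y"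
      unfolding y_def by (induction m) (auto intro!: homogeneous_vec_add)
    have "D (Suc p) y = (\<Sum>t<m. D (Suc p) (kscale (r t) (u t)))"
      unfolding y_def by (rule module_hom.sum[OF D_hom])
    also have "\<dots> = D (Suc p) (bvec b)"
      unfolding r k_smul by (intro sum.cong) (auto simp: D_smul u(3))
    finally have "bvec b - y \<in> bdry (Suc p)"
      unfolding bdry_Suc using True y_free
      by (simp add: D_diff free_mod_diff bvec_free_mod)
    moreover have "homogeneous_vec deg (s (Suc p)) a (bvec b - y)"
      using True y_hom homogeneous_vec_bvec[of "s (Suc p)" b] by (intro homogeneous_vec_diff) auto
    ultimately obtain v where v: "v \<in> free_mod (B (Suc (Suc p)))"
        "homogeneous_vec deg (s (Suc (Suc p))) a v" "D (Suc (Suc p)) v = bvec b - y"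
      using homogeneous_lift by blast
    have "pair \<Phi> (bvec b - y) = pair (cobd {a} (Suc p) \<Phi>) v"
      using pair_D[OF convex _ v(1,2), of \<Phi>] cyc by (simp add: v(3) cocycle_def)
    then have "\<Phi> b = pair \<Phi> y"
      using cyc by (simp add: pair_diff cocycle_def pair_eq_zero)
    also have "\<dots> = 0"
      unfolding y_def by (simp add: pair_sum kscale_def pair_smul \<Phi>u)
    finally show ?thesis .
  qed
  then have "\<Phi> = (\<lambda>_. 0)"
    by auto
  then have "coboundary {a} (Suc p) (\<lambda>b. \<Sum>i<n. c i * \<phi> i b)"
    unfolding \<Phi>_def[symmetric] using coboundary_zero by simp
  then show False
    using ind c(1) by blast
qed

end

section \<open>An injective evaluation in a field\<close>

lemma poly_mapping_sum_single: "(\<Sum>m\<in>supp f. Poly_Mapping.single m (lk f m)) = f"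
proof (rule poly_mapping_eqI)
  fix m
  have "lk (\<Sum>m\<in>supp f. Poly_Mapping.single m (lk f m)) m
      = (\<Sum>m'\<in>supp f. if m' = m then lk f m' else 0)"
    unfolding lookup_sum by (intro sum.cong) (auto simp: lookup_single when_def)
  also have "\<dots> = lk f m"
    by (simp add: in_keys_iff)
  finally show "lk (\<Sum>m\<in>supp f. Poly_Mapping.single m (lk f m)) m = lk f m" .
qed

text \<open>The field of fractions of \<open>S\<close>, after numbering the variables by an injection \<open>idx\<close>: a linear order on
  the exponents is what shows that the polynomial ring is a domain.\<close>

lemma injective_evaluation:
  obtains ev :: "('x::finite, 'k::field) mpoly \<Rightarrow> ((nat \<Rightarrow>\<^sub>0 nat) \<Rightarrow>\<^sub>0 'k) fract"
  where "\<And>f g. ev (f + g) = ev f + ev g" "\<And>f g. ev (f * g) = ev f * ev g" "ev 1 = 1"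
    "\<And>f. f \<noteq> 0 \<Longrightarrow> ev f \<noteq> 0"
proof -
  obtain idx :: "'x \<Rightarrow> nat" where idx: "inj idx"
    using finite_imp_inj_to_nat_seg[of "UNIV :: 'x set"] by auto
  define e :: "('x \<Rightarrow>\<^sub>0 nat) \<Rightarrow> (nat \<Rightarrow>\<^sub>0 nat)" where
    "e m = (\<Sum>x\<in>UNIV. Poly_Mapping.single (idx x) (lk m x))" for m
  have e_add: "e (m + m') = e m + e m'" for m m'
    by (simp add: e_def lookup_add single_add sum.distrib)
  have e_zero: "e 0 = 0"
    by (simp add: e_def)
  have "lk (e m) (idx x) = lk m x" for m x
  proof -
    have "lk (e m) (idx x) = (\<Sum>y\<in>UNIV. if y = x then lk m y else 0)"
      unfolding e_def lookup_sum
      by (intro sum.cong) (use idx in \<open>auto simp: lookup_single when_def inj_def\<close>)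
    then show ?thesis by simp
  qed
  then have e_inj: "e m = e m' \<longleftrightarrow> m = m'" for m m'
    by (metis poly_mapping_eqI)
  define E :: "('x, 'k) mpoly \<Rightarrow> (nat \<Rightarrow>\<^sub>0 nat) \<Rightarrow>\<^sub>0 'k" where
    "E f = (\<Sum>m\<in>supp f. Poly_Mapping.single (e m) (lk f m))" for f
  have E_sup: "E f = (\<Sum>m\<in>A. Poly_Mapping.single (e m) (lk f m))"
    if "finite A" "supp f \<subseteq> A" for f A
    unfolding E_def using that
    by (intro sum.mono_neutral_left) (auto simp: in_keys_iff)
  have E_add: "E (f + g) = E f + E g" for f g
  proof -
    let ?A = "supp f \<union> supp g"
    have "E (f + g) = (\<Sum>m\<in>?A. Poly_Mapping.single (e m) (lk (f + g) m))"
      by (rule E_sup) (use Poly_Mapping.keys_add[of f g] in auto)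
    also have "\<dots> = (\<Sum>m\<in>?A. Poly_Mapping.single (e m) (lk f m))
        + (\<Sum>m\<in>?A. Poly_Mapping.single (e m) (lk g m))"
      by (simp add: lookup_add single_add sum.distrib)
    also have "\<dots> = E f + E g"
      by (simp add: E_sup[symmetric])
    finally show ?thesis .
  qed
  have E_zero: "E 0 = 0"
    by (simp add: E_def)
  have E_sum: "E (\<Sum>i\<in>A. h i) = (\<Sum>i\<in>A. E (h i))" for A :: "('x \<Rightarrow>\<^sub>0 nat) set" and h
    by (induction A rule: infinite_finite_induct) (auto simp: E_add E_zero)
  have E_single: "E (Poly_Mapping.single m c) = Poly_Mapping.single (e m) c" for m c
    by (simp add: E_def)
  have E_mult: "E (f * g) = E f * E g" for f g
  proof -
    have "E (f * g) = E ((\<Sum>m\<in>supp f. Poly_Mapping.single m (lk f m))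
        * (\<Sum>m\<in>supp g. Poly_Mapping.single m (lk g m)))"
      by (simp add: poly_mapping_sum_single)
    also have "\<dots> = E f * E g"
      unfolding sum_product E_sum mult_single E_single e_add E_def[of f] E_def[of g] ..
    finally show ?thesis .
  qed
  have E_nz: "E f \<noteq> 0" if "f \<noteq> 0" for f
  proof -
    obtain m where m: "lk f m \<noteq> 0"
      using \<open>f \<noteq> 0\<close> by (metis poly_mapping_eqI lookup_zero)
    have "lk (E f) (e m) = (\<Sum>m'\<in>supp f. if m' = m then lk f m' else 0)"
      unfolding E_def lookup_sum
      by (intro sum.cong) (auto simp: lookup_single when_def e_inj)
    also have "\<dots> = lk f m"
      by (simp add: in_keys_iff)
    finally show ?thesis using m by auto
  qed
  show ?thesis
  proof (rule that[of "\<lambda>f. Fract (E f) 1"])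
    show "Fract (E 1) 1 = 1"
      using E_single[of 0 1] by (simp add: e_zero One_fract_def)
  qed (auto simp: E_add E_mult Zero_fract_def eq_fract E_nz)
qed

section \<open>Ideals with linear resolution\<close>

lemma lookup_color_deg: "lk (color_deg col m) i = (\<Sum>x\<in>UNIV. if col x = i then lk m x else 0)"
  by (simp add: color_deg_def lookup_sum lookup_single when_def)

lemma color_deg_add: "color_deg col (m + m') = color_deg col m + color_deg col m'"
  by (simp add: color_deg_def lookup_add single_add sum.distrib)

lemma weight_color_deg: "weight (color_deg col m) = total_deg m"
proof -
  have "(\<Sum>i\<in>UNIV. lk (color_deg col m) i) = (\<Sum>x\<in>UNIV. \<Sum>i\<in>UNIV. if col x = i then lk m x else 0)"
    unfolding lookup_color_deg by (rule sum.swap)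
  then show ?thesis
    by (simp add: weight_def total_deg_def)
qed

lemma total_deg_add: "total_deg (m + m') = total_deg m + total_deg m'"
  by (simp add: total_deg_def lookup_add sum.distrib)

lemma total_deg_pos: "m \<noteq> 0 \<Longrightarrow> total_deg m \<ge> 1"
proof -
  assume "m \<noteq> 0"
  then obtain x where "lk m x \<noteq> 0"
    by (metis poly_mapping_eqI lookup_zero)
  moreover have "lk m x \<le> (\<Sum>x\<in>UNIV. lk m x)"
    by (rule member_le_sum) auto
  ultimately show ?thesis
    unfolding total_deg_def by linarith
qed

lemma total_deg_nonneg: "total_deg m \<ge> 0"
  unfolding total_deg_def by linarith

lemma module_times: "module ((*) :: 'a::comm_ring_1 \<Rightarrow> 'a \<Rightarrow> 'a)"
  by unfold_locales (simp_all add: algebra_simps)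

lemma generated_in_degree_lower_bound:
  assumes gen: "generated_in_degree e I" and "f \<in> I" "m \<in> supp f"
  shows "total_deg m \<ge> e"
proof -
  interpret times: module "(*) :: ('a, 'b) mpoly \<Rightarrow> _" by (rule module_times)
  have "f \<in> times.span {f \<in> I. homogeneous total_deg e f}"
    using assms by (auto simp: generated_in_degree_def ideal_gen_def)
  then have "\<forall>m\<in>supp f. total_deg m \<ge> e"
  proof (induction rule: times.span_induct_alt)
    case base
    then show ?case by simp
  next
    case (step c g h)
    show ?case
    proof
      fix m assume "m \<in> supp (c * g + h)"
      then consider "m \<in> supp (c * g)" | "m \<in> supp h"
        using Poly_Mapping.keys_add[of "c * g" h] by blast
      then show "total_deg m \<ge> e"
      proof cases
        case 1
        then obtain m1 m2 where "m2 \<in> supp g" "m = m1 + m2"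
          by (rule keys_mult_elim)
        then show ?thesis
          using step(1) by (auto simp: homogeneous_def total_deg_add total_deg_nonneg)
      qed (use step in auto)
    qed
  qed
  then show ?thesis using assms(3) by blast
qed

lemma quotient_resolution_graded:
  assumes "quotient_resolution deg B s D I" and deg_add: "\<And>m m'. deg (m + m') = deg m + deg m'"
  obtains b0 where "graded_resolution deg B s D I b0"
proof -
  interpret grading deg
    by unfold_locales (rule deg_add)
  obtain b0 where b0: "B 0 = {b0}" "s 0 b0 = 0"
      "D 1 ` free_mod (B 1) = Poly_Mapping.single b0 ` I"
    and c: "graded_free_complex deg B s D"
    using assms(1) by (auto simp: quotient_resolution_def)
  have "graded_resolution deg B s D I b0"
  proof
    fix p
    have hom: "module_hom smul smul (D (Suc p))"
      and free: "D (Suc p) ` free_mod (B (Suc p)) \<subseteq> free_mod (B p)"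
      and graded: "\<forall>v\<in>free_mod (B (Suc p)). \<forall>g. homogeneous_vec deg (s (Suc p)) g v
        \<longrightarrow> homogeneous_vec deg (s p) g (D (Suc p) v)"
      and exact: "{v \<in> free_mod (B (Suc p)). D (Suc p) v = 0}
        = D (Suc (Suc p)) ` free_mod (B (Suc (Suc p)))"
      using c unfolding graded_free_complex_def by simp_all
    show "D (Suc p) (v + w) = D (Suc p) v + D (Suc p) w" for v w
      by (rule module_hom.add[OF hom])
    show "D (Suc p) (smul r v) = smul r (D (Suc p) v)" for r v
      by (rule module_hom.scale[OF hom])
    show "v \<in> free_mod (B (Suc p)) \<Longrightarrow> D (Suc p) v \<in> free_mod (B p)" for v
      using free by auto
    show "b \<in> B (Suc p) \<Longrightarrow> homogeneous_vec deg (s p) (s (Suc p) b) (D (Suc p) (bvec b))" for b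
      using graded by (simp add: homogeneous_vec_bvec bvec_free_mod)
    show "{v \<in> free_mod (B (Suc p)). D (Suc p) v = 0}
        = D (Suc (Suc p)) ` free_mod (B (Suc (Suc p)))"
      by (rule exact)
  qed (use b0 in auto)
  then show ?thesis by (rule that)
qed

text \<open>Splicing \<open>\<epsilon>\<close> with the inclusion of \<open>I\<close> in \<open>S\<close> turns a resolution of \<open>I\<close> into one of \<open>S/I\<close>, with all
  indices raised by one.\<close>

lemma ideal_resolution_shift:
  assumes res: "ideal_resolution deg B s D \<epsilon> I"
  shows "quotient_resolution deg (case_nat {b0} B) (case_nat (\<lambda>_. 0) s)
    (case_nat (D 0) (case_nat (\<lambda>v. Poly_Mapping.single b0 (\<epsilon> v)) (\<lambda>p. D (Suc p)))) I"
    (is "quotient_resolution deg ?B ?s ?D I")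
proof -
  have c: "graded_free_complex deg B s D"
    and \<epsilon>: "module_hom smul (*) \<epsilon>"
    and \<epsilon>_hom: "\<And>v g. v \<in> free_mod (B 0) \<Longrightarrow> homogeneous_vec deg (s 0) g v \<Longrightarrow> homogeneous deg g (\<epsilon> v)"
    and img: "\<epsilon> ` free_mod (B 0) = I"
    and ker: "{v \<in> free_mod (B 0). \<epsilon> v = 0} = D 1 ` free_mod (B 1)"
    using res by (auto simp: ideal_resolution_def)
  interpret \<epsilon>: module_hom smul "(*)" \<epsilon> by fact
  have "graded_free_complex deg ?B ?s ?D"
    unfolding graded_free_complex_def
  proof
    fix p
    show "module_hom smul smul (?D (Suc p)) \<and> ?D (Suc p) ` free_mod (?B (Suc p)) \<subseteq> free_mod (?B p)
      \<and> (\<forall>v\<in>free_mod (?B (Suc p)). \<forall>g. homogeneous_vec deg (?s (Suc p)) g v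
            \<longrightarrow> homogeneous_vec deg (?s p) g (?D (Suc p) v))
      \<and> {v \<in> free_mod (?B (Suc p)). ?D (Suc p) v = 0}
          = ?D (Suc (Suc p)) ` free_mod (?B (Suc (Suc p)))"
    proof (cases p)
      case 0
      have "module_hom smul smul (\<lambda>v. Poly_Mapping.single b0 (\<epsilon> v))"
        by unfold_locales (simp_all add: \<epsilon>.add \<epsilon>.scale single_add smul_single)
      moreover have "homogeneous_vec deg (\<lambda>_. 0) g (Poly_Mapping.single b0 (\<epsilon> v))"
        if "v \<in> free_mod (B 0)" "homogeneous_vec deg (s 0) g v" for v g
        using \<epsilon>_hom[OF that]
        by (auto simp: homogeneous_vec_iff homogeneous_def lookup_single when_def in_keys_iff)
      moreover have "(Poly_Mapping.single b0 (\<epsilon> v) = 0) = (\<epsilon> v = 0)" for v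
        by (metis lookup_single_eq lookup_zero single_zero)
      ultimately show ?thesis
        using ker by (auto simp: 0 free_mod_def split: if_splits)
    next
      case (Suc q)
      then show ?thesis
        using c unfolding graded_free_complex_def by simp
    qed
  qed
  moreover have "?D 1 ` free_mod (?B 1) = Poly_Mapping.single b0 ` I"
    using img by (auto simp: image_image[symmetric])
  ultimately show ?thesis
    by (simp add: quotient_resolution_def)
qed

text \<open>Regularity bounds the degrees of the generators from above, and minimality bounds them from
  below: a basis vector of \<open>G\<^sub>p\<^sub>+\<^sub>1\<close> has a nonzero image (otherwise it would be a boundary and lie in
  \<open>\<mm> G\<^sub>p\<^sub>+\<^sub>1\<close>), and the entries of its image have positive degree, so the degree grows by at least
  one in each step.\<close>

lemma regular_ideal_linear_resolution:
  assumes gen: "generated_in_degree (d + 1) I" and reg: "regular_ideal (d + 1) I"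
  obtains B :: "nat \<Rightarrow> nat set" and s :: "nat \<Rightarrow> nat \<Rightarrow> int" and D b0
  where "graded_resolution total_deg B s D I b0"
    "\<And>p b. b \<in> B (Suc p) \<Longrightarrow> s (Suc p) b = d + int (Suc p)"
proof -
  obtain B :: "nat \<Rightarrow> nat set" and s D \<epsilon> where fin: "\<And>p. finite (B p)"
    and res: "ideal_resolution total_deg B s D \<epsilon> I" and min: "minimal_complex B D"
    and upper: "\<And>p i. card {b \<in> B p. s p b = i} \<noteq> 0 \<Longrightarrow> i \<le> d + 1 + int p"
    using reg unfolding regular_ideal_def by metis
  define B' where "B' = case_nat {0} B"
  define s' where "s' = case_nat (\<lambda>_. 0) s"
  define D' where "D' = case_nat (D 0) (case_nat (\<lambda>v. Poly_Mapping.single 0 (\<epsilon> v)) (\<lambda>p. D (Suc p)))"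
  have simps: "B' (Suc p) = B p" "s' (Suc p) = s p" "D' (Suc (Suc p)) = D (Suc p)"
    "D' (Suc 0) = (\<lambda>v. Poly_Mapping.single 0 (\<epsilon> v))" for p
    by (simp_all add: B'_def s'_def D'_def)
  have "quotient_resolution total_deg B' s' D' I"
    unfolding B'_def s'_def D'_def by (rule ideal_resolution_shift[OF res])
  then obtain b0 where G: "graded_resolution total_deg B' s' D' I b0"
    using total_deg_add by (rule quotient_resolution_graded)
  interpret G: graded_resolution total_deg B' s' D' I b0 by fact
  have nonzero: "D' (Suc p) (bvec b) \<noteq> 0" if b: "b \<in> B' (Suc p)" for p b
  proof
    assume "D' (Suc p) (bvec b) = 0"
    then have "bvec b \<in> G.bdry (Suc p)"
      using b by (simp add: G.bdry_Suc bvec_free_mod)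
    then obtain v where "v \<in> free_mod (B (Suc p))" "bvec b = D (Suc p) v"
      by (auto simp: G.bdry_def simps)
    then have "lk (lk (bvec b :: nat \<Rightarrow>\<^sub>0 ('a, 'b) mpoly) b) 0 = 0"
      using min unfolding minimal_complex_def by metis
    then show False by simp
  qed
  have lower: "s' (Suc p) b \<ge> d + int (Suc p)" if b: "b \<in> B' (Suc p)" for p b
    using b
  proof (induction p arbitrary: b)
    case 0
    have "D' (Suc 0) (bvec b) \<in> Poly_Mapping.single b0 ` I"
      using 0 by (simp add: G.image_D1[symmetric] bvec_free_mod)
    then obtain f where f: "f \<in> I" "D' (Suc 0) (bvec b) = Poly_Mapping.single b0 f"
      by blast
    then have "f \<noteq> 0"
      using nonzero[OF 0] by auto
    then obtain m where m: "m \<in> supp f"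
      by (metis ex_in_conv keys_eq_empty)
    have "s' 0 b0 + total_deg m = s' (Suc 0) b"
      using G.D_bvec_homogeneous[OF 0] m \<open>f \<noteq> 0\<close> by (auto simp: homogeneous_vec_def f(2))
    then show ?case
      using generated_in_degree_lower_bound[OF gen f(1) m] by (simp add: G.s_0)
  next
    case (Suc p)
    let ?v = "D' (Suc (Suc p)) (bvec b)"
    obtain b' where b': "b' \<in> supp ?v"
      using nonzero[OF Suc.prems] by (metis ex_in_conv keys_eq_empty)
    obtain m where m: "m \<in> supp (lk ?v b')"
      using keys_lookup_nonempty[OF b'] by blast
    have "lk (lk ?v b') 0 = 0"
      using min[unfolded minimal_complex_def, rule_format, OF bvec_free_mod] Suc.prems
      by (simp add: simps)
    then have "m \<noteq> 0"
      using m by (auto simp: in_keys_iff)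
    then have "total_deg m \<ge> 1"
      by (rule total_deg_pos)
    moreover have "s' (Suc p) b' + total_deg m = s' (Suc (Suc p)) b"
      using G.D_bvec_homogeneous[OF Suc.prems] b' m by (auto simp: homogeneous_vec_def)
    moreover have "b' \<in> B' (Suc p)"
      using G.D_free[OF bvec_free_mod[OF Suc.prems]] b' by (rule free_modD)
    ultimately show ?case
      using Suc.IH[of b'] by simp
  qed
  show ?thesis
  proof (rule that[OF G])
    fix p b assume b: "b \<in> B' (Suc p)"
    then have "card {b' \<in> B p. s p b' = s' (Suc p) b} \<noteq> 0"
      using fin[of p] by (auto simp: simps)
    then show "s' (Suc p) b = d + int (Suc p)"
      using upper[of p "s' (Suc p) b"] lower[OF b] by simp
  qed
qed

text \<open>This settles the zero multidegree, where no coordinate can be fixed.\<close>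

lemma kdim_pos:
  assumes "v \<in> V" "v \<noteq> 0"
  shows "enat 1 \<le> kdim V"
proof (rule ccontr)
  assume "\<not> enat 1 \<le> kdim V"
  then have less: "kdim V < enat 1"
    by simp
  obtain m w where "m < 1" "\<exists>r. v = (\<Sum>t<(m::nat). kscale (r t) (w t))"
    by (rule kdim_basis[OF less]) (use assms(1) in blast)
  then show False
    using assms(2) by simp
qed

lemma face_supp: "face (supp a) a = {a}"
proof -
  have "c = a" if c: "c \<in> face (supp a) a" for c
  proof (rule poly_mapping_eqI)
    fix i
    have "lk c i \<in> (if i \<in> supp a then {lk a i} else {..lk a i})"
      using c by (simp add: face_def box_def)
    then show "lk c i = lk a i"
      by (auto simp: in_keys_iff split: if_splits)
  qed
  then show ?thesis
    by (auto simp: face_def box_def)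
qed

theorem theorem4p3:
  fixes col :: "'x::finite \<Rightarrow> 'c::finite"
    and I :: "('x, 'k::field) mpoly set"
    and d :: int
    and B :: "nat \<Rightarrow> 'b set"
    and s :: "nat \<Rightarrow> 'b \<Rightarrow> ('c \<Rightarrow>\<^sub>0 nat)"
    and D :: "nat \<Rightarrow> ('b \<Rightarrow>\<^sub>0 ('x, 'k) mpoly) \<Rightarrow> ('b \<Rightarrow>\<^sub>0 ('x, 'k) mpoly)"
    and l :: nat
    and a :: "'c \<Rightarrow>\<^sub>0 nat"
  assumes "homogeneous_ideal (color_deg col) I"
    and "generated_in_degree (d + 1) I"
    and "regular_ideal (d + 1) I"
    and "\<And>i. \<exists>f\<in>I. pure_color col i f"
    and "quotient_resolution (color_deg col) B s D I"
    and "1 \<le> l" and "l \<le> CARD('c)"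
    and "int (\<Sum>i\<in>UNIV. Poly_Mapping.lookup a i) = d + int l"
  shows "enat ((card {i. Poly_Mapping.lookup a i \<noteq> 0} - 1) choose (l - 1))
           \<le> kdim (syzygy_piece (color_deg col) B s D l a)"
proof -
  note gen = assms(2) and reg = assms(3) and pure = assms(4)
  obtain p where l: "l = Suc p"
    using assms(6) by (cases l) auto
  have tot: "weight a = d + int (Suc p)"
    using assms(8) by (simp add: weight_def l)
  have supp_a: "{i. lk a i \<noteq> 0} = supp a"
    by (auto simp: in_keys_iff)
  obtain b0 where F: "graded_resolution (color_deg col) B s D I b0"
    using assms(5) color_deg_add by (rule quotient_resolution_graded)
  interpret F: graded_resolution "color_deg col" B s D I b0 by fact
  show ?thesis
  proof (cases "supp a = {}")
    case True
    then have a: "a = 0" by simp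
    show ?thesis
    proof (cases p)
      case (Suc q)
      then show ?thesis
        using True by (simp add: supp_a l flip: zero_enat_def)
    next
      case 0
      then have d: "d + 1 = 0"
        using tot by (simp add: a weight_def)
      interpret times: module "(*) :: ('x, 'k) mpoly \<Rightarrow> _" by (rule module_times)
      obtain f where "f \<in> I" "f \<noteq> 0"
        using pure[of undefined] by (auto simp: pure_color_def has_color_vector_def)
      \<comment> \<open>Here \<open>a = 0\<close> and \<open>l = 1\<close>, so \<open>d = -1\<close> and \<open>I\<close> is generated by constants. The binomial
          coefficient is 1, as \<open>0 - 1 = 0\<close> for natural numbers.\<close>
      have "\<exists>g\<in>I. g \<noteq> 0 \<and> homogeneous total_deg 0 g"
      proof (rule ccontr)
        assume "\<not> ?thesis"
        then have "{f \<in> I. homogeneous total_deg (d + 1) f} \<subseteq> {0}"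
          by (auto simp: d)
        then have "times.span {f \<in> I. homogeneous total_deg (d + 1) f} \<subseteq> {0}"
          by (rule times.span_minimal[OF _ times.subspace_single_0])
        moreover have "I = times.span {f \<in> I. homogeneous total_deg (d + 1) f}"
          using gen unfolding generated_in_degree_def ideal_gen_def by (rule conjunct2)
        ultimately have "I \<subseteq> {0}"
          by simp
        then show False
          using \<open>f \<in> I\<close> \<open>f \<noteq> 0\<close> by auto
      qed
      then obtain g where g: "g \<in> I" "g \<noteq> 0" "homogeneous total_deg 0 g"
        by blast
      have "color_deg col m = 0" if "m \<in> supp g" for m
      proof -
        have "m = 0"
          using g(3) that total_deg_pos[of m] by (auto simp: homogeneous_def)
        then show ?thesis
          by (simp add: F.deg_zero)
      qed
      then have "homogeneous_vec (color_deg col) (s 0) 0 (Poly_Mapping.single b0 g)"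
        by (auto simp: homogeneous_vec_iff lookup_single when_def F.s_0 in_keys_iff)
      then have "Poly_Mapping.single b0 g \<in> syzygy_piece (color_deg col) B s D l a"
        using g(1) by (simp add: syzygy_piece_def syzygy_def l 0 a F.image_D1)
      moreover have "Poly_Mapping.single b0 g \<noteq> 0"
        using g(2) by (metis lookup_single_eq lookup_zero)
      ultimately show ?thesis
        using kdim_pos by (simp add: True supp_a l 0)
    qed
  next
    case False
    obtain ev :: "('x, 'k) mpoly \<Rightarrow> ((nat \<Rightarrow>\<^sub>0 nat) \<Rightarrow>\<^sub>0 'k) fract"
      where ev: "\<And>f g. ev (f + g) = ev f + ev g" "\<And>f g. ev (f * g) = ev f * ev g" "ev 1 = 1"
        and ev_nz: "\<And>f. f \<noteq> 0 \<Longrightarrow> ev f \<noteq> 0"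
      by (rule injective_evaluation) blast
    obtain B' :: "nat \<Rightarrow> nat set" and s' D' b0' where
      G: "graded_resolution total_deg B' s' D' I b0'"
      and lin: "\<And>p b. b \<in> B' (Suc p) \<Longrightarrow> s' (Suc p) b = d + int (Suc p)"
      using regular_ideal_linear_resolution[OF gen reg] by metis
    interpret F: evaluated_resolution "color_deg col" B s D I b0 ev
      by unfold_locales (rule ev)+
    interpret F: linear_setting "color_deg col" B s D I b0 ev d
    proof
      fix \<Gamma> p
      assume convex: "F.convex_degs \<Gamma>" and \<Gamma>: "\<And>c. c \<in> \<Gamma> \<Longrightarrow> weight c \<noteq> d + int (Suc p)"
      show "F.acyclic_at \<Gamma> (Suc p)"
      proof (rule F.acyclic_compare[OF convex weight_add])
        show "graded_resolution (\<lambda>m. weight (color_deg col m)) B' s' D' I b0'"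
          unfolding weight_color_deg by (rule G)
      qed (use \<Gamma> lin in auto)
    next
      fix \<Gamma> p i
      assume convex: "F.convex_degs \<Gamma>"
        and \<Gamma>: "\<And>c n. c \<in> \<Gamma> \<longleftrightarrow> c + Poly_Mapping.single i n \<in> \<Gamma>"
      obtain f n where f: "f \<in> I" "f \<noteq> 0" "homogeneous (color_deg col) (Poly_Mapping.single i n) f"
        using pure[of i] by (auto simp: pure_color_def has_color_vector_def)
      show "F.acyclic_at \<Gamma> p"
        by (rule F.acyclic_invariant[OF convex \<Gamma> f(1,3) ev_nz[OF f(2)]])
    next
      fix b assume b: "b \<in> B 1" "weight (s 1 b) \<le> d"
      then obtain f where f: "f \<in> I" "D 1 (bvec b) = Poly_Mapping.single b0 f"
        using F.image_D1 bvec_free_mod[of b "B 1"] by auto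
      have "m \<notin> supp f" for m
      proof
        assume m: "m \<in> supp f"
        then have "s 0 b0 + color_deg col m = s 1 b"
          using F.D_bvec_homogeneous[of b 0] b f(2) by (simp add: homogeneous_vec_iff in_keys_iff)
        then have "total_deg m \<le> d"
          using b(2) by (simp add: F.s_0 flip: weight_color_deg[of col])
        then show False
          using generated_in_degree_lower_bound[OF gen f(1) m] by simp
      qed
      then show "D 1 (bvec b) = 0"
        using f(2) by (metis ex_in_conv keys_eq_empty single_zero)
    qed
    have "F.many_classes {a} (Suc p) ((card (supp a) - 1) choose p)"
      using F.many_classes_face[OF _ False order_refl tot] by (simp add: face_supp)
    moreover have "F.convex_degs {a}"
      using F.convex_face[of "supp a" a] by (simp add: face_supp)
    ultimately have "enat ((card (supp a) - 1) choose p)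
        \<le> kdim (syzygy_piece (color_deg col) B s D (Suc p) a)"
      by (rule F.kdim_syzygy_piece)
    then show ?thesis
      by (simp only: l supp_a diff_Suc_1)
  qed
qed

end
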